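(* Let $(G,p,\ell)$ be a point-hyperplane framework in $\mathbb{R}^d$ with $t$-fold extrusion symmetry, where the points and hyperplanes affinely span $\mathbb{R}^d$, and let $\rho_i$ be an irreducible representation of $\Gamma=\mathbb{Z}_2^t$. If $(p,\ell)$ is a regular point of $G$ in $(p,\ell)+X^{(\rho_i)}$ and there exists a $\rho_i$-symmetric infinitesimal flex of $(G,p,\ell)$, then there also exists a finite flex of $(G,p,\ell)$.
   Context: **Frameworks.** A $\mathcal{PH}$-graph is a finite simple graph $G=(V_{\mathcal P}\cup V_{\mathcal H},E)$ with vertex set partitioned into non-empty sets $V_{\mathcal P}$ (size $n$) and $V_{\mathcal H}$ (size $k$); $E$ is partitioned into $E_{\mathcal{PP}},E_{\mathcal{PH}},E_{\mathcal{HH}}$ by types of end-vertices. A point-hyperplane framework $(G,p,\ell)$ in $\mathbb{R}^d$ has maps $p:V_{\mathcal P}\to\mathbb{R}^d$, $\ell=(a,r):V_{\mathcal H}\to(\mathbb{R}^d\setminus\{0\})\times\mathbb{R}$; $j\in V_{\mathcal H}$ represents the hyperplane $\{x:\langle a_j,x\rangle=r_j\}$. The points and hyperplanes affinely span $\mathbb{R}^d$ if the points $p_i$ together with all points on the hyperplanes affinely span $\mathbb{R}^d$. $E_{\mathcal{HH}\parallel}$ is the set of edges of $E_{\mathcal{HH}}$ whose hyperplanes are parallel at $(p,\ell)$, $E_{\mathcal{HH}\not\parallel}$ the other edges of $E_{\mathcal{HH}}$; the parallel classes are the connected components of $(V_{\mathcal H},E_{\mathcal{HH}\parallel})$. **Graph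 and extrusion symmetry.** $G=H\square_{F_1,\ldots,F_t}K_2^{\square t}$ ($t\geq1$), where $H$ is a $\mathcal{PH}$-graph and $F_1,\ldots,F_t\subseteq V_{\mathcal H}(H)$: the Cartesian product $H\square K_2^{\square t}$ has vertices $(u,\mathbf e)$, $u\in V(H)$, $\mathbf e\in\{0,1\}^t$, and edges $\{(u,\mathbf e),(u',\mathbf e)\}$ for $\{u,u'\}\in E(H)$ and $\{(u,\mathbf e),(u,\mathbf e')\}$ for $\mathbf e,\mathbf e'$ differing in exactly one entry; $G$ arises from it by contracting, for each $h$ and $w\in F_h$, all pairs $(w,\mathbf e),(w,\mathbf e')$ differing only in the $h$-th entry to one vertex, whose $h$-th entry is written $\star$, removing edges between contracted vertices (and identifying multiple edges). A vertex $(u,\mathbf e)$ has the type (point or hyperplane) of $u$. $\Gamma$ acts on $G$ by $\gamma(u,\mathbf e)=(u,\mathbf e+\gamma)$, addition mod 2, $\star+0=\star+1=\star$. Given $\tau_1,\ldots,\tau_t$, for $i=(u,\mathbf e)$ put $\tau_\gamma(i)=\sum_{h:\mathbf e_h=0,\gamma_h=1}\tau_h-\sum_{g:\mathbf e_g=1,\gamma_g=1}\tau_g$. $(G,p,\ell)$ has $t$-fold extrusion symmetry if there are $\tau_1,\ldots,\tau_t\in\mathbb{R}^d\setminus\{0\}$ such that for all $\gamma$: (i) $p_{\gamma i}=p_i+\tau_\gamma(i)$ for $i\in V_{\mathcal P}$; (ii) $a_{\gamma j}=a_j$ for $j\in V_{\mathcal H}$; (iii) $\langle\tau_h,a_{(w,\mathbf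 e)}\rangle=0$ whenever $w\in F_h$; (iv) $r_{\gamma j}=r_j+\langle a_j,\tau_\gamma(j)\rangle$ for $j\in V_{\mathcal H}$. **Symmetric vectors.** The external representation $P'_V$ of $\Gamma$ on $\mathbb{R}^{dn+(d+1)k}$ is $(P_{V_{\mathcal P}}\otimes I_d)\oplus P'_{V_{\mathcal H}}$, where $P_S(\gamma)=[\delta_{i,\gamma j}]_{i,j\in S}$ and $P'_{V_{\mathcal H}}(\gamma)$ is obtained from $P_{V_{\mathcal H}}(\gamma)$ by replacing each $0$ by the $(d+1)\times(d+1)$ zero matrix and each $1$ in entry $(i,j)$ by $\begin{pmatrix}I_d&\mathbf 0\\-\tau_\gamma(i)^T&1\end{pmatrix}$. The irreducible representations of $\Gamma$ are the homomorphisms $\Gamma\to\{1,-1\}$. $X^{(\rho_i)}$ is the space of $\rho_i$-symmetric vectors, i.e. of $u$ with $P'_V(\gamma)u=\rho_i(\gamma)u$ for all $\gamma$. **Infinitesimal flexes.** An infinitesimal motion $(\dot p,\dot\ell)$, $\dot\ell_j=(\dot a_j,\dot r_j)$, satisfies: $\langle p_i-p_j,\dot p_i-\dot p_j\rangle=0$ for $\{i,j\}\in E_{\mathcal{PP}}$; $\langle p_i,\dot a_j\rangle+\langle\dot p_i,a_j\rangle-\dot r_j=0$ for $\{i,j\}\in E_{\mathcal{PH}}$; $\langle a_i,\dot a_j\rangle+\langle\dot a_i,a_j\rangle=0$ for $\{i,j\}\in E_{\mathcal{HH}\not\parallel}$; $\langle c\,\dot a_i-\dot a_j,\alpha\rangle=0$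 for all $\alpha$ orthogonal to $a_i$, for $\{i,j\}\in E_{\mathcal{HH}\parallel}$ with $a_j=c\,a_i$; and $\langle a_j,\dot a_j\rangle=0$ for $j\in V_{\mathcal H}$. It is trivial if $\dot p_i=Sp_i+b$ and $(\dot a_j,\dot r_j)=(Sa_j,\langle b,a_j\rangle)$ for some skew-symmetric $S$ and $b\in\mathbb{R}^d$; otherwise it is an infinitesimal flex. It is $\rho_i$-symmetric if it lies in $X^{(\rho_i)}$. **Regularity and finite flexes.** $\mathbb{W}_G$ is the set of $(q,m)\in\mathbb{R}^{dn+(d+1)k}$, $m_j=(a_j,r_j)$, with $a_i\parallel a_j$ for all $\{i,j\}\in E_{\mathcal{HH}\parallel}$. $f_G$ on $\mathbb{W}_G$ has components $\|q_i-q_j\|^2$ ($\{i,j\}\in E_{\mathcal{PP}}$), $\langle q_i,a_j\rangle-r_j$ ($\{i,j\}\in E_{\mathcal{PH}}$), $\langle a_i,a_j\rangle$ ($\{i,j\}\in E_{\mathcal{HH}\not\parallel}$), $\langle a_j,a_j\rangle$ ($j\in V_{\mathcal H}$). $f_{K}$ is defined in the same way for the complete graph $K$ on $V$, with hyperplane-hyperplane edges counted as parallel iff both ends lie in the same parallel class. Let $\tilde f_G^{(i)}$ be the restriction of $f_G$ to the affine space $(p,\ell)+X^{(\rho_i)}$ (taken to lie in the domain $\mathbb{W}_G$ of $f_G$). A point $(q,m)$ is a regular point of $G$ in $(p,\ell)+X^{(\rho_i)}$ if there is a neighborhood $N$ of $(q,m)$ in $(p,\ell)+X^{(\rho_i)}$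 with $\mathrm{rank}\,d\tilde f_G^{(i)}((q,m))=\max\{\mathrm{rank}\,d\tilde f_G^{(i)}((q',m')):(q',m')\in N\}$. A finite flex of $(G,p,\ell)$ is a differentiable path $x:[0,1]\to\mathbb{W}_G$ with $x(0)=(p,\ell)$ and $x(T)\in f_G^{-1}(f_G(p,\ell))\setminus f_K^{-1}(f_K(p,\ell))$ for all $T\in(0,1]$. *)

theory Defs
  imports "HOL-Analysis.Analysis" "HOL-Library.Z2"
begin

section \<open>Point-hyperplane graphs\<close>

record 'v ph_graph =
  pts :: "'v set"
  hyps :: "'v set"
  edges :: "'v set set"

abbreviation verts :: "'v ph_graph \<Rightarrow> 'v set"
  where "verts G \<equiv> pts G \<union> hyps G"

definition is_ph_graph :: "'v ph_graph \<Rightarrow> bool"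
  where "is_ph_graph G \<longleftrightarrow>
    finite (verts G) \<and> pts G \<noteq> {} \<and> hyps G \<noteq> {} \<and> pts G \<inter> hyps G = {} \<and>
    edges G \<subseteq> {{u, v} | u v. u \<in> verts G \<and> v \<in> verts G \<and> u \<noteq> v}"

definition complete_on :: "'v ph_graph \<Rightarrow> 'v ph_graph"
  where "complete_on G = G\<lparr>edges := {{u, v} | u v. u \<in> verts G \<and> v \<in> verts G \<and> u \<noteq> v}\<rparr>"

section \<open>Point-hyperplane frameworks\<close>

text \<open>
  A pair \<open>(q, m)\<close> consists of point positions \<open>q\<close> and hyperplane data \<open>m $ j = (a\<^sub>j, r\<^sub>j)\<close>.
  The index type \<open>'v\<close> may be larger than the vertex set of \<open>G\<close>; the space
  \<open>\<real>\<^bsup>dn+(d+1)k\<^esup>\<close> is the subspace \<open>config_space G\<close> of pairs that vanish at all indices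
  that are not point vertices (for \<open>q\<close>) or not hyperplane vertices (for \<open>m\<close>).
\<close>

type_synonym ('d, 'v) config = "((real^'d)^'v) \<times> (((real^'d) \<times> real)^'v)"

definition config_space :: "'v::finite ph_graph \<Rightarrow> ('d::finite, 'v) config set"
  where "config_space G = {(q, m). (\<forall>i. i \<notin> pts G \<longrightarrow> q $ i = 0) \<and> (\<forall>j. j \<notin> hyps G \<longrightarrow> m $ j = 0)}"

fun framework :: "'v::finite ph_graph \<Rightarrow> ('d::finite, 'v) config \<Rightarrow> bool"
  where "framework G (p, l) \<longleftrightarrow> (p, l) \<in> config_space G \<and> (\<forall>j\<in>hyps G. fst (l $ j) \<noteq> 0)"

fun affinely_spanning :: "'v::finite ph_graph \<Rightarrow> ('d::finite, 'v) config \<Rightarrow> bool"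
  where "affinely_spanning G (p, l) \<longleftrightarrow>
    affine hull ((\<lambda>i. p $ i) ` pts G \<union> (\<Union>j\<in>hyps G. {x. fst (l $ j) \<bullet> x = snd (l $ j)})) = UNIV"

text \<open>For non-zero vectors this says that each is a scalar multiple of the other.\<close>

abbreviation parallel :: "real^'d \<Rightarrow> real^'d \<Rightarrow> bool"
  where "parallel a b \<equiv> collinear {0, a, b}"

fun par_edges :: "'v::finite ph_graph \<Rightarrow> ('d::finite, 'v) config \<Rightarrow> 'v set set"
  where "par_edges G (p, l) =
    {{i, j} | i j. i \<in> hyps G \<and> j \<in> hyps G \<and> {i, j} \<in> edges G \<and> parallel (fst (l $ i)) (fst (l $ j))}"

text \<open>The hyperplane-hyperplane edges of the complete graph that count as parallel.\<close>

definition class_edges :: "'v::finite ph_graph \<Rightarrow> ('d::finite, 'v) config \<Rightarrow> 'v set set"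
  where "class_edges G pl =
    {{i, j} | i j. i \<in> hyps G \<and> j \<in> hyps G \<and> i \<noteq> j \<and> (i, j) \<in> {(u, v). {u, v} \<in> par_edges G pl}\<^sup>*}"

section \<open>Measurement map\<close>

text \<open>
  In the following two definitions \<open>B\<close> is the set of hyperplane-hyperplane edges counted as
  parallel.
\<close>

definition W_set :: "'v::finite ph_graph \<Rightarrow> 'v set set \<Rightarrow> ('d::finite, 'v) config set"
  where "W_set G B = {(q, m) \<in> config_space G.
    \<forall>i\<in>hyps G. \<forall>j\<in>hyps G. {i, j} \<in> B \<longrightarrow> parallel (fst (m $ i)) (fst (m $ j))}"

text \<open>
  The four parts of the value list the measurements for point-point edges, point-hyperplane edges,
  non-parallel hyperplane-hyperplane edges, and hyperplane vertices. They are indexed by ordered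
  pairs, so that the symmetric measurements occur twice; the entries at all other indices are
  constantly \<open>0\<close>. Neither affects fibres of the map or ranks of its differential. The formulas are
  used on the whole ambient space, and the domain \<^term>\<open>W_set G B\<close> is imposed separately.
\<close>

fun f_map :: "'v::finite ph_graph \<Rightarrow> 'v set set \<Rightarrow> ('d::finite, 'v) config \<Rightarrow>
    (real^'v^'v) \<times> (real^'v^'v) \<times> (real^'v^'v) \<times> (real^'v)"
  where "f_map G B (q, m) =
    (\<chi> i j. if i \<in> pts G \<and> j \<in> pts G \<and> {i, j} \<in> edges G then (norm (q $ i - q $ j))\<^sup>2 else 0,
     \<chi> i j. if i \<in> pts G \<and> j \<in> hyps G \<and> {i, j} \<in> edges G
            then q $ i \<bullet> fst (m $ j) - snd (m $ j) else 0,
     \<chi> i j. if i \<in> hyps G \<and> j \<in> hyps G \<and> {i, j} \<in> edges G - B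
            then fst (m $ i) \<bullet> fst (m $ j) else 0,
     \<chi> j. if j \<in> hyps G then fst (m $ j) \<bullet> fst (m $ j) else 0)"

section \<open>Infinitesimal and finite flexes\<close>

fun infinitesimal_motion ::
    "'v::finite ph_graph \<Rightarrow> ('d::finite, 'v) config \<Rightarrow> ('d, 'v) config \<Rightarrow> bool"
  where "infinitesimal_motion G (p, l) (q, m) \<longleftrightarrow>
    (q, m) \<in> config_space G \<and>
    (\<forall>i\<in>pts G. \<forall>j\<in>pts G. {i, j} \<in> edges G \<longrightarrow> (p $ i - p $ j) \<bullet> (q $ i - q $ j) = 0) \<and>
    (\<forall>i\<in>pts G. \<forall>j\<in>hyps G. {i, j} \<in> edges G \<longrightarrow>
       p $ i \<bullet> fst (m $ j) + q $ i \<bullet> fst (l $ j) - snd (m $ j) = 0) \<and>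
    (\<forall>i\<in>hyps G. \<forall>j\<in>hyps G. {i, j} \<in> edges G - par_edges G (p, l) \<longrightarrow>
       fst (l $ i) \<bullet> fst (m $ j) + fst (m $ i) \<bullet> fst (l $ j) = 0) \<and>
    (\<forall>i\<in>hyps G. \<forall>j\<in>hyps G. {i, j} \<in> par_edges G (p, l) \<longrightarrow>
       (\<forall>c. fst (l $ j) = c *\<^sub>R fst (l $ i) \<longrightarrow>
         (\<forall>\<alpha>. \<alpha> \<bullet> fst (l $ i) = 0 \<longrightarrow> (c *\<^sub>R fst (m $ i) - fst (m $ j)) \<bullet> \<alpha> = 0))) \<and>
    (\<forall>j\<in>hyps G. fst (l $ j) \<bullet> fst (m $ j) = 0)"

fun trivial_motion ::
    "'v::finite ph_graph \<Rightarrow> ('d::finite, 'v) config \<Rightarrow> ('d, 'v) config \<Rightarrow> bool"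
  where "trivial_motion G (p, l) (q, m) \<longleftrightarrow>
    (\<exists>(S :: real^'d^'d) b. transpose S = - S \<and>
      (\<forall>i\<in>pts G. q $ i = S *v (p $ i) + b) \<and>
      (\<forall>j\<in>hyps G. m $ j = (S *v fst (l $ j), b \<bullet> fst (l $ j))))"

definition infinitesimal_flex ::
    "'v::finite ph_graph \<Rightarrow> ('d::finite, 'v) config \<Rightarrow> ('d, 'v) config \<Rightarrow> bool"
  where "infinitesimal_flex G pl u \<longleftrightarrow> infinitesimal_motion G pl u \<and> \<not> trivial_motion G pl u"

definition finite_flex ::
    "'v::finite ph_graph \<Rightarrow> ('d::finite, 'v) config \<Rightarrow> (real \<Rightarrow> ('d, 'v) config) \<Rightarrow> bool"
  where "finite_flex G pl x \<longleftrightarrow>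
    (let B = par_edges G pl; K = complete_on G; C = class_edges G pl in
      x differentiable_on {0..1} \<and> x ` {0..1} \<subseteq> W_set G B \<and> x 0 = pl \<and>
      (\<forall>T\<in>{0<..1}. x T \<in> {y \<in> W_set G B. f_map G B y = f_map G B pl}
                      - {y \<in> W_set K C. f_map K C y = f_map K C pl}))"

section \<open>Regular points\<close>

text \<open>
  For \<open>x\<close> in a submanifold \<open>S\<close>, \<open>tangent_space S x\<close> is the usual tangent space; for affine \<open>S\<close> it is
  the direction space of \<open>S\<close>. \<open>restricted_rank S f x\<close> is the rank at \<open>x\<close> of the differential of the
  restriction of \<open>f\<close> to \<open>S\<close>. (In the library, \<open>dim\<close> of a set is the dimension of its span.)
\<close>

definition tangent_space :: "'a::real_normed_vector set \<Rightarrow> 'a \<Rightarrow> 'a set"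
  where "tangent_space S x =
    {v. \<exists>c :: real \<Rightarrow> 'a. c 0 = x \<and> (\<forall>\<^sub>F s in nhds 0. c s \<in> S) \<and> (c has_vector_derivative v) (at 0)}"

definition restricted_rank ::
    "'a::real_normed_vector set \<Rightarrow> ('a \<Rightarrow> 'b::euclidean_space) \<Rightarrow> 'a \<Rightarrow> nat"
  where "restricted_rank S f x = dim (frechet_derivative f (at x) ` tangent_space S x)"

text \<open>
  \<open>f_map\<close> is restricted to the part of the affine space \<open>A\<close> lying in its domain \<^const>\<open>W_set\<close>. Near
  a framework and for the \<open>A\<close> used below, this part is a smooth manifold. If \<open>A\<close> lies in the domain,
  it is \<open>A\<close> itself.
\<close>

definition regular_point_in ::
    "('d::finite, 'v) config set \<Rightarrow> 'v::finite ph_graph \<Rightarrow> ('d, 'v) config \<Rightarrow> ('d, 'v) config \<Rightarrow> bool"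
  where "regular_point_in A G pl x \<longleftrightarrow>
    (let B = par_edges G pl; D = A \<inter> W_set G B in
      x \<in> D \<and>
      (\<exists>N. openin (top_of_set A) N \<and> x \<in> N \<and>
        (\<forall>y\<in>N \<inter> D. restricted_rank D (f_map G B) y \<le> restricted_rank D (f_map G B) x)))"

section \<open>Extrusion graphs\<close>

instance bit :: finite
proof
  have "(UNIV :: bit set) = {0, 1}"
    by auto
  then show "finite (UNIV :: bit set)"
    by (metis finite.emptyI finite_insert)
qed

text \<open>
  The group \<open>\<Gamma> = \<int>\<^sub>2\<^sup>t\<close> is the type \<^typ>\<open>bit^'t\<close>, where \<open>t\<close> is the cardinality of \<open>'t\<close>. The first graph
  below is the Cartesian product of \<open>H\<close> with the \<open>t\<close>-dimensional cube.
\<close>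

definition cube_product :: "'v ph_graph \<Rightarrow> ('v \<times> (bit^'t::finite)) ph_graph"
  where "cube_product H = \<lparr>pts = pts H \<times> UNIV, hyps = hyps H \<times> UNIV,
    edges = {{(u, e), (u', e)} | u u' e. {u, u'} \<in> edges H} \<union>
            {{(u, e), (u, e')} | u e e'. u \<in> verts H \<and> (\<exists>!h. e $ h \<noteq> e' $ h)}\<rparr>"

text \<open>
  The entry \<open>\<star>\<close> of a contracted vertex is \<open>None\<close>. Two vertices of the product are contracted to one
  vertex iff they have the same image under \<open>star_at F\<close>. Images of edges between contracted
  vertices are singletons and are removed.
\<close>

fun star_at :: "('t::finite \<Rightarrow> 'v set) \<Rightarrow> 'v \<times> (bit^'t) \<Rightarrow> 'v \<times> ((bit option)^'t)"
  where "star_at F (u, e) = (u, \<chi> h. if u \<in> F h then None else Some (e $ h))"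

definition extrusion :: "'v ph_graph \<Rightarrow> ('t::finite \<Rightarrow> 'v set) \<Rightarrow> ('v \<times> ((bit option)^'t)) ph_graph"
  where "extrusion H F = (let P = cube_product H in
    \<lparr>pts = star_at F ` pts P, hyps = star_at F ` hyps P,
     edges = {star_at F ` \<epsilon> | \<epsilon>. \<epsilon> \<in> edges P \<and> card (star_at F ` \<epsilon>) = 2}\<rparr>)"

section \<open>Extrusion symmetry\<close>

fun act :: "bit^'t::finite \<Rightarrow> 'v \<times> ((bit option)^'t) \<Rightarrow> 'v \<times> ((bit option)^'t)"
  where "act \<gamma> (u, e) = (u, \<chi> h. map_option (\<lambda>b. b + \<gamma> $ h) (e $ h))"

fun shift :: "('t \<Rightarrow> real^'d) \<Rightarrow> bit^'t::finite \<Rightarrow> 'v \<times> ((bit option)^'t) \<Rightarrow> real^'d::finite"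
  where "shift \<tau> \<gamma> (u, e) =
    (\<Sum>h | e $ h = Some 0 \<and> \<gamma> $ h = 1. \<tau> h) - (\<Sum>g | e $ g = Some 1 \<and> \<gamma> $ g = 1. \<tau> g)"

text \<open>Extrusion symmetry of \<open>(extrusion H F, p, l)\<close> with the translation vectors \<open>\<tau>\<close>.\<close>

fun extrusion_symmetric :: "'v::finite ph_graph \<Rightarrow> ('t::finite \<Rightarrow> 'v set) \<Rightarrow>
    ('t \<Rightarrow> real^'d::finite) \<Rightarrow> ('d, 'v \<times> ((bit option)^'t)) config \<Rightarrow> bool"
  where "extrusion_symmetric H F \<tau> (p, l) \<longleftrightarrow>
    (\<forall>h. \<tau> h \<noteq> 0) \<and>
    (\<forall>\<gamma>. \<forall>i\<in>pts (extrusion H F). p $ act \<gamma> i = p $ i + shift \<tau> \<gamma> i) \<and>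
    (\<forall>\<gamma>. \<forall>j\<in>hyps (extrusion H F). fst (l $ act \<gamma> j) = fst (l $ j)) \<and>
    (\<forall>h w e. w \<in> F h \<and> (w, e) \<in> hyps (extrusion H F) \<longrightarrow> \<tau> h \<bullet> fst (l $ (w, e)) = 0) \<and>
    (\<forall>\<gamma>. \<forall>j\<in>hyps (extrusion H F). snd (l $ act \<gamma> j) = snd (l $ j) + fst (l $ j) \<bullet> shift \<tau> \<gamma> j)"

section \<open>Symmetric vectors\<close>

text \<open>
  The external representation, written as the application of its block matrix: the sums run over the
  block columns, and the entry \<open>(i, j)\<close> is a non-zero block iff \<open>i = act \<gamma> j\<close>.
\<close>

fun ext_rep :: "('v \<times> ((bit option)^'t)) ph_graph \<Rightarrow> ('t \<Rightarrow> real^'d) \<Rightarrow> bit^'t \<Rightarrow>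
    ('d::finite, 'v::finite \<times> ((bit option)^'t::finite)) config \<Rightarrow> ('d, 'v \<times> ((bit option)^'t)) config"
  where "ext_rep G \<tau> \<gamma> (q, m) =
    (\<chi> i. \<Sum>j\<in>pts G. if i = act \<gamma> j then q $ j else 0,
     \<chi> i. \<Sum>j\<in>hyps G. if i = act \<gamma> j
            then (fst (m $ j), - (shift \<tau> \<gamma> i \<bullet> fst (m $ j)) + snd (m $ j)) else 0)"

definition irreducible_rep :: "(bit^'t::finite \<Rightarrow> real) \<Rightarrow> bool"
  where "irreducible_rep \<rho> \<longleftrightarrow> (\<forall>\<gamma>. \<rho> \<gamma> \<in> {1, -1}) \<and> (\<forall>\<gamma> \<delta>. \<rho> (\<gamma> + \<delta>) = \<rho> \<gamma> * \<rho> \<delta>)"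

definition symmetric_vectors :: "('v \<times> ((bit option)^'t)) ph_graph \<Rightarrow> ('t \<Rightarrow> real^'d) \<Rightarrow>
    (bit^'t \<Rightarrow> real) \<Rightarrow> ('d::finite, 'v::finite \<times> ((bit option)^'t::finite)) config set"
  where "symmetric_vectors G \<tau> \<rho> = {u \<in> config_space G. \<forall>\<gamma>. ext_rep G \<tau> \<gamma> u = \<rho> \<gamma> *\<^sub>R u}"

end

(*
  An infinitesimal flex that is tangent to the constrained configurations D (symmetric ones with
  prescribed parallelism) lies in the kernel of the differential of the restricted measurement map.
  As the rank of the latter is locally maximal at (p, l), this kernel vector is the velocity of a
  curve in a fibre of the restricted map. To see this, D is parametrized by a quadratic map: for a
  non-trivial representation D is affine near (p, l), and for the trivial one each parallel class
  is described by one normal vector and scalar factors.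

  If the curve met congruent configurations at times accumulating at 0, all inner products of
  normals and differences of points would be preserved at these times, and their first-order
  behaviour would be an infinitesimal rigid motion. As the flex is not trivial, the curve leaves
  the fibre of the complete graph immediately.
*)

theory Submission
  imports Defs
begin

section \<open>Curves in the fibres of maps of locally maximal rank\<close>

text \<open>A kernel vector of a differential is the velocity of a curve in the fibre only if the
  rank does not jump. Regularity bounds the rank only for the restricted map, and the argument never
  establishes that \<open>D\<close> is a manifold. Two one-sided comparisons suffice. Velocities of
  the chart are tangent to \<open>D\<close>, so near \<open>(p, l)\<close> the pulled-back
  differential has at most the restricted rank. At \<open>(p, l)\<close> itself the chart realizes
  every tangent vector, so there its rank is at least the restricted one. The chart has a quadratic
  term because turning the common direction of a parallel class and rescaling its individual normals
  are each linear, while doing both produces their product. Under a non-trivial representation no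
  turning is possible, so straight lines through \<open>(p, l)\<close> suffice.\<close>

lemma linear_generalized_inverse:
  fixes N :: "'a::euclidean_space \<Rightarrow> 'b::euclidean_space"
  assumes "linear N"
  obtains L where "linear L" "\<And>w. N (L (N w)) = N w" "\<And>y. L (N (L y)) = L y"
proof -
  obtain h where h: "linear h" "\<And>w. N (h (N w)) = N w"
    using linear_exists_right_inverse_on[OF assms subspace_UNIV] by blast
  show thesis
  proof
    \<comment> \<open>Only \<open>N h N = N\<close> is known of \<open>h\<close>; passing to
      \<open>h N h\<close> adds the second identity.\<close>
    show "linear (\<lambda>y. h (N (h y)))"
      using assms h(1) by (simp add: linear_iff)
  qed (use h(2) in auto)
qed

text \<open>The rank bound makes \<open>L\<close> injective on the range of \<open>M\<close>: the
  subspace \<open>V\<close> of that range already maps onto the range of \<open>L M\<close>, so by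
  dimension it is the whole range, and an element of \<open>V\<close> is recovered from its image
  under \<open>L\<close> by applying \<open>M h\<close>.\<close>

lemma kernel_comp_eq_of_dim_range:
  fixes M :: "'a::euclidean_space \<Rightarrow> 'b::euclidean_space"
    and L :: "'b \<Rightarrow> 'c::euclidean_space"
  assumes M: "linear M" and L: "linear L"
    and dim: "dim (range M) \<le> dim (range (\<lambda>w. L (M w)))"
    and ker: "L (M w) = 0"
  shows "M w = 0"
proof -
  have LM: "linear (\<lambda>w. L (M w))"
    using M L by (simp add: linear_iff)
  then obtain h where h: "linear h" "\<And>w. L (M (h (L (M w)))) = L (M w)"
    using linear_generalized_inverse by metis
  define V where "V = range (\<lambda>w. M (h (L (M w))))"
  have "linear (\<lambda>w. M (h (L (M w))))"
    using M h(1) LM by (simp add: linear_iff)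
  then have V: "subspace V"
    unfolding V_def by (simp add: linear_subspace_image)
  have "L ` V = range (\<lambda>w. L (M w))"
    by (simp add: V_def image_image h(2))
  then have "dim (range (\<lambda>w. L (M w))) \<le> dim V"
    using dim_image_le[OF L, of V] by simp
  then have "V = range M"
    using dim V M by (intro subspace_dim_equal) (auto simp: V_def linear_subspace_image)
  then obtain y where y: "M w = M (h (L (M y)))"
    unfolding V_def by blast
  then have "L (M y) = 0"
    using ker h(2) by metis
  then show ?thesis
    using y linear_0[OF h(1)] linear_0[OF M] by simp
qed

text \<open>
  With \<open>N\<close> the derivative at \<open>z0\<close> and \<open>L\<close> a generalized inverse of \<open>N\<close>, the map
  \<open>\<Phi> z = L (g z - g z0) + (z - z0) - L (N (z - z0))\<close> has derivative \<open>id\<close> at \<open>z0\<close>, so the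
  curve \<open>t \<mapsto> \<Phi>\<inverse> (t u)\<close> exists. As \<open>L \<circ> N \<circ> \<Phi>'\<close> is \<open>L \<circ> g'\<close>, the velocity of this curve
  lies in the kernel of \<open>L \<circ> g'\<close>, which by the rank condition is the kernel of \<open>g'\<close>.
\<close>

lemma constant_rank_curve:
  fixes g :: "'a::euclidean_space \<Rightarrow> 'b::euclidean_space" and g' :: "'a \<Rightarrow> 'a \<Rightarrow>\<^sub>L 'b"
  assumes der: "\<And>z. (g has_derivative g' z) (at z)"
    and cont: "continuous_on UNIV g'"
    and rank: "\<forall>\<^sub>F z in nhds z0. dim (range (g' z)) \<le> dim (range (g' z0))"
    and u: "g' z0 u = 0"
  obtains c c' :: "real \<Rightarrow> 'a" and e where "e > 0" "c 0 = z0" "c' 0 = u"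
    "\<And>t. \<bar>t\<bar> < e \<Longrightarrow> (c has_vector_derivative c' t) (at t)"
    "\<And>t. \<bar>t\<bar> < e \<Longrightarrow> g (c t) = g z0"
proof -
  define N where "N = blinfun_apply (g' z0)"
  have N: "linear N"
    unfolding N_def by (simp add: blinfun.bounded_linear_right bounded_linear.linear)
  obtain L0 where L0: "linear L0" "\<And>w. N (L0 (N w)) = N w" "\<And>y. L0 (N (L0 y)) = L0 y"
    using linear_generalized_inverse[OF N] by metis
  define L where "L = Blinfun L0"
  have L_apply: "blinfun_apply L = L0"
    unfolding L_def using L0(1) by (simp add: bounded_linear_Blinfun_apply linear_conv_bounded_linear)
  define \<Phi> where "\<Phi> z = L (g z - g z0) + (z - z0) - L (g' z0 (z - z0))" for z
  define \<Phi>' where "\<Phi>' z = (L o\<^sub>L g' z) + id_blinfun - (L o\<^sub>L g' z0)" for z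
  have \<Phi>'_apply: "\<Phi>' z w = L0 (g' z w) + w - L0 (N w)" for z w
    by (simp add: \<Phi>'_def blinfun.bilinear_simps L_apply N_def)
  have der\<Phi>: "(\<Phi> has_derivative \<Phi>' z) (at z)" for z
    unfolding \<Phi>_def
    by (rule has_derivative_eq_rhs, (rule derivative_eq_intros der refl)+)
       (auto simp: fun_eq_iff \<Phi>'_apply L_apply N_def blinfun.diff_right)
  have cont\<Phi>: "continuous_on UNIV \<Phi>'"
    unfolding \<Phi>'_def by (intro continuous_intros cont)
  have id: "id_blinfun o\<^sub>L \<Phi>' z0 = id_blinfun"
    by (intro blinfun_eqI) (simp add: \<Phi>'_apply N_def)
  have \<Phi>0: "\<Phi> z0 = 0"
    by (simp add: \<Phi>_def blinfun.bilinear_simps)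
  obtain U V \<psi> \<psi>' where inv: "open U" "z0 \<in> U" "open V" "\<Phi> z0 \<in> V" "homeomorphism U V \<Phi> \<psi>"
    and der\<psi>: "\<And>y. y \<in> V \<Longrightarrow> (\<psi> has_derivative \<psi>' y) (at y)"
    and \<psi>': "\<And>y. y \<in> V \<Longrightarrow> \<psi>' y = Hilbert_Choice.inv (\<Phi>' (\<psi> y))"
    and bij: "\<And>y. y \<in> V \<Longrightarrow> bij (\<Phi>' (\<psi> y))"
    by (rule inverse_function_theorem[OF open_UNIV der\<Phi> cont\<Phi> UNIV_I id]) blast
  have \<psi>0: "\<psi> 0 = z0"
    using inv \<Phi>0 by (metis homeomorphism_apply1)
  obtain W where W: "open W" "z0 \<in> W" "\<And>z. z \<in> W \<Longrightarrow> dim (range (g' z)) \<le> dim (range (g' z0))"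
    using rank by (auto simp: eventually_nhds)
  \<comment> \<open>The curve has to stay both where \<open>\<psi>\<close> inverts
    \<open>\<Phi>\<close> and where the rank bound holds.\<close>
  have "open (V \<inter> \<psi> -` W)"
    using inv W by (intro continuous_open_preimage) (auto simp: homeomorphism_def)
  moreover have "continuous_on UNIV (\<lambda>t::real. t *\<^sub>R u)"
    by (intro continuous_intros)
  ultimately have "open ((\<lambda>t::real. t *\<^sub>R u) -` (V \<inter> \<psi> -` W))"
    by (rule open_vimage)
  moreover have "0 \<in> (\<lambda>t::real. t *\<^sub>R u) -` (V \<inter> \<psi> -` W)"
    using inv \<Phi>0 \<psi>0 W by simp
  ultimately obtain e where e: "e > 0" "ball 0 e \<subseteq> (\<lambda>t::real. t *\<^sub>R u) -` (V \<inter> \<psi> -` W)"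
    using open_contains_ball by blast
  define c where "c t = \<psi> (t *\<^sub>R u)" for t
  define c' where "c' t = \<psi>' (t *\<^sub>R u) u" for t
  have inV: "t *\<^sub>R u \<in> V" and inW: "c t \<in> W" if "\<bar>t\<bar> < e" for t
    using e that by (auto simp: c_def dist_norm subset_iff)
  have derc: "(c has_vector_derivative c' t) (at t)" if "\<bar>t\<bar> < e" for t
  proof -
    have D: "(\<psi> has_derivative \<psi>' (t *\<^sub>R u)) (at (t *\<^sub>R u))"
      using der\<psi> inV that by blast
    have "((\<lambda>t. t *\<^sub>R u) has_derivative (\<lambda>s. s *\<^sub>R u)) (at t)"
      by (auto intro!: derivative_eq_intros)
    from has_derivative_compose[OF this D] show ?thesis
      using linear_cmul[OF has_derivative_linear[OF D]]
      by (simp add: has_vector_derivative_def c_def[abs_def] c'_def)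
  qed
  have "g' (c t) (c' t) = 0" if t: "\<bar>t\<bar> < e" for t
  proof -
    have surj: "surj (\<Phi>' (c t))"
      using bij inV t unfolding c_def bij_def by blast
    have "\<Phi>' (c t) (c' t) = u"
      using surj \<psi>' inV t by (simp add: c'_def c_def[symmetric] surj_f_inv_f)
    moreover have LN: "L0 (N (\<Phi>' (c t) w)) = L0 (g' (c t) w)" for w
      using L0 N by (simp add: \<Phi>'_apply linear_add linear_diff)
    ultimately have ker: "L0 (g' (c t) (c' t)) = 0"
      using u linear_0[OF L0(1)] by (metis N_def)
    \<comment> \<open>The chain bounds the rank of \<open>g' (c t)\<close> by the rank of its
      composition with \<open>L0\<close>; hence \<open>L0\<close> kills no non-zero vector of its
      range.\<close>
    have "dim (range (g' (c t))) \<le> dim (range N)"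
      using W inW t by (simp add: N_def)
    also have "range N = N ` range (\<lambda>w. L0 (N w))"
      by (simp add: image_image L0)
    also have "dim \<dots> \<le> dim (range (\<lambda>w. L0 (N w)))"
      by (rule dim_image_le[OF N])
    also have "range (\<lambda>w. L0 (N w)) = (\<lambda>w. L0 (N w)) ` range (\<Phi>' (c t))"
      using surj by simp
    also have "\<dots> = range (\<lambda>w. L0 (g' (c t) w))"
      by (simp add: image_image LN)
    finally show ?thesis
      using kernel_comp_eq_of_dim_range[of "blinfun_apply (g' (c t))" L0 "c' t"] L0(1) ker
      by (simp add: blinfun.bounded_linear_right bounded_linear.linear)
  qed
  then have const: "((\<lambda>t. g (c t)) has_derivative (\<lambda>h. 0)) (at t within ball 0 e)" if "t \<in> ball 0 e" for t
    using has_derivative_compose[OF derc[unfolded has_vector_derivative_def] der] that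
    by (simp add: blinfun.scaleR_right has_derivative_at_withinI)
  show thesis
  proof
    show "e > 0" by fact
    show "c 0 = z0"
      by (simp add: c_def \<psi>0)
    have "blinfun_apply (\<Phi>' z0) = id"
      by (simp add: fun_eq_iff \<Phi>'_apply N_def)
    then show "c' 0 = u"
      using \<psi>'[of 0] inv \<Phi>0 \<psi>0 by (simp add: c'_def)
    show "(c has_vector_derivative c' t) (at t)" if "\<bar>t\<bar> < e" for t
      by (rule derc[OF that])
    show "g (c t) = g z0" if "\<bar>t\<bar> < e" for t
      using has_derivative_zero_unique[OF convex_ball const, of t 0] that e
      by (simp add: c_def \<psi>0 dist_norm)
  qed
qed


text \<open>
  \<open>\<phi>\<close> need not parametrize a neighbourhood of \<open>x0\<close> in \<open>D\<close>: it suffices that its image is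
  contained in \<open>D\<close> and that every tangent vector of \<open>D\<close> at the single point \<open>x0\<close> is in \<open>T\<close>.
\<close>

lemma regular_constrained_curve:
  fixes f :: "'a::euclidean_space \<Rightarrow> 'b::euclidean_space" and f' :: "'a \<Rightarrow> 'a \<Rightarrow>\<^sub>L 'b"
    and \<phi> :: "'a \<Rightarrow> 'a" and \<phi>' :: "'a \<Rightarrow> 'a \<Rightarrow>\<^sub>L 'a"
  assumes derf: "\<And>x. (f has_derivative f' x) (at x)" and contf: "continuous_on UNIV f'"
    and der\<phi>: "\<And>v. (\<phi> has_derivative \<phi>' v) (at v)" and cont\<phi>: "continuous_on UNIV \<phi>'"
    and T: "subspace T"
    and \<phi>0: "\<phi> 0 = x0" "\<forall>v\<in>T. \<phi>' 0 v = v"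
    and \<phi>D: "\<forall>v\<in>T. \<phi> v \<in> D"
    and tangent: "tangent_space D x0 \<subseteq> T"
    and reg: "\<forall>\<^sub>F y in nhds x0. y \<in> D \<longrightarrow> restricted_rank D f y \<le> restricted_rank D f x0"
    and u: "u \<in> T" "f' x0 u = 0"
  shows "\<exists>c e. e > 0 \<and> c 0 = x0 \<and> (c has_vector_derivative u) (at 0) \<and>
    (\<forall>t. \<bar>t\<bar> < e \<longrightarrow> c differentiable at t \<and> c t \<in> D \<and> f (c t) = f x0)"
proof -
  \<comment> \<open>Composing with a linear projection onto \<open>T\<close> extends the chart to
    the whole space, where \<open>constant_rank_curve\<close> applies, while its values stay in
    \<open>D\<close>.\<close>
  obtain P0 where P0: "linear P0" "P0 ` UNIV \<subseteq> T" "\<And>v. v \<in> T \<Longrightarrow> P0 v = v"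
    using linear_exists_left_inverse_on[OF linear_id T] by auto
  define P where "P = Blinfun P0"
  have P_apply: "blinfun_apply P = P0"
    unfolding P_def using P0(1) by (simp add: bounded_linear_Blinfun_apply linear_conv_bounded_linear)
  have PT: "P v \<in> T" for v
    using P0(2) by (auto simp: P_apply)
  have P_id: "P v = v" if "v \<in> T" for v
    using P0(3) that by (simp add: P_apply)
  define g where "g z = f (\<phi> (P z))" for z
  define g' where "g' z = f' (\<phi> (P z)) o\<^sub>L \<phi>' (P z) o\<^sub>L P" for z
  have der\<phi>P: "((\<lambda>z. \<phi> (P z)) has_derivative (\<lambda>w. \<phi>' (P z) (P w))) (at z)" for z
    by (rule has_derivative_compose[OF bounded_linear_imp_has_derivative[OF blinfun.bounded_linear_right] der\<phi>])
  have g'_apply: "blinfun_apply (g' z) = (\<lambda>w. f' (\<phi> (P z)) (\<phi>' (P z) (P w)))" for z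
    by (simp add: g'_def fun_eq_iff)
  have derg: "(g has_derivative g' z) (at z)" for z
    using has_derivative_compose[OF der\<phi>P derf] by (simp add: g_def[abs_def] g'_apply)
  have cont\<phi>P: "continuous_on UNIV (\<lambda>z. \<phi> (P z))"
    using has_derivative_continuous[OF der\<phi>P] by (simp add: continuous_on_eq_continuous_at)
  have contg: "continuous_on UNIV g'"
    unfolding g'_def
    by (intro continuous_intros continuous_on_compose2[OF contf] continuous_on_compose2[OF cont\<phi>] cont\<phi>P) auto
  \<comment> \<open>A line in \<open>T\<close> is sent into \<open>D\<close>, so each velocity of
    the chart is a tangent vector of \<open>D\<close>.\<close>
  have range_le: "range (g' z) \<subseteq> frechet_derivative f (at (\<phi> (P z))) ` tangent_space D (\<phi> (P z))" for z
  proof -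
    have "\<phi>' (P z) (P w) \<in> tangent_space D (\<phi> (P z))" for w
    proof -
      have "\<phi> (P z + s *\<^sub>R P w) \<in> D" for s
        using \<phi>D PT T by (simp add: subspace_add subspace_mul)
      moreover have "((\<lambda>s. \<phi> (P z + s *\<^sub>R P w)) has_vector_derivative \<phi>' (P z) (P w)) (at 0)"
      proof -
        have "((\<lambda>s. P z + s *\<^sub>R P w) has_derivative (\<lambda>s. s *\<^sub>R P w)) (at 0)"
          by (auto intro!: derivative_eq_intros)
        from has_derivative_compose[OF this der\<phi>] show ?thesis
          by (simp add: has_vector_derivative_def blinfun.scaleR_right)
      qed
      ultimately show ?thesis
        unfolding tangent_space_def by (auto intro!: exI[of _ "\<lambda>s. \<phi> (P z + s *\<^sub>R P w)"])
    qed
    then show ?thesis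
      using frechet_derivative_at[OF derf, of "\<phi> (P z)"] by (auto simp: g'_apply)
  qed
  have P_0: "P 0 = 0"
    by simp
  have "((\<lambda>z. \<phi> (P z)) \<longlongrightarrow> x0) (nhds 0)"
    using has_derivative_continuous[OF der\<phi>P, of 0]
      tendsto_at_iff_tendsto_nhds[of "\<lambda>z. \<phi> (P z)" 0] \<phi>0(1) P_0
    by (simp add: continuous_at)
  then have "\<forall>\<^sub>F z in nhds 0. \<phi> (P z) \<in> D \<longrightarrow> restricted_rank D f (\<phi> (P z)) \<le> restricted_rank D f x0"
    using reg by (rule eventually_compose_filterlim[rotated])
  moreover have "dim (range (g' z)) \<le> dim (range (g' 0))"
    if "\<phi> (P z) \<in> D \<longrightarrow> restricted_rank D f (\<phi> (P z)) \<le> restricted_rank D f x0" for z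
  proof -
    have "dim (range (g' z)) \<le> restricted_rank D f (\<phi> (P z))"
      unfolding restricted_rank_def by (rule dim_subset[OF range_le])
    also have "\<dots> \<le> restricted_rank D f x0"
      using that \<phi>D PT by blast
    \<comment> \<open>The reverse comparison is made at \<open>x0\<close> only: there
      \<open>\<phi>'\<close> is the identity on \<open>T\<close>, which contains all tangent vectors
      of \<open>D\<close>.\<close>
    also have "\<dots> \<le> dim (range (g' 0))"
      unfolding restricted_rank_def
    proof (rule dim_subset, rule image_subsetI)
      fix v
      assume "v \<in> tangent_space D x0"
      then have "frechet_derivative f (at x0) v = g' 0 v"
        using tangent \<phi>0 P_id P_0 frechet_derivative_at[OF derf, of x0] by (auto simp: g'_def)
      then show "frechet_derivative f (at x0) v \<in> range (g' 0)"
        by simp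
    qed
    finally show ?thesis .
  qed
  ultimately have rank: "\<forall>\<^sub>F z in nhds 0. dim (range (g' z)) \<le> dim (range (g' 0))"
    by (rule eventually_mono)
  have "g' 0 u = 0"
    using u \<phi>0 P_id P_0 by (simp add: g'_def)
  then obtain c c' :: "real \<Rightarrow> 'a" and e where e: "e > 0" and c0: "c 0 = 0" "c' 0 = u"
    and derc: "\<And>t. \<bar>t\<bar> < e \<Longrightarrow> (c has_vector_derivative c' t) (at t)"
    and gc: "\<And>t. \<bar>t\<bar> < e \<Longrightarrow> g (c t) = g 0"
    by (rule constant_rank_curve[OF derg contg rank]) blast
  have der: "((\<lambda>t. \<phi> (P (c t))) has_vector_derivative \<phi>' (P (c t)) (P (c' t))) (at t)" if "\<bar>t\<bar> < e" for t
    using has_derivative_compose[OF derc[OF that, unfolded has_vector_derivative_def] der\<phi>P]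
    by (simp add: has_vector_derivative_def blinfun.scaleR_right)
  show ?thesis
  proof (intro exI[of _ "\<lambda>t. \<phi> (P (c t))"] exI[of _ e] conjI allI impI)
    show "0 < e" by fact
    show "\<phi> (P (c 0)) = x0"
      by (simp add: c0 P_0 \<phi>0)
    show "((\<lambda>t. \<phi> (P (c t))) has_vector_derivative u) (at 0)"
      using der[of 0] e u \<phi>0 P_id by (simp add: c0 P_0)
    show "(\<lambda>t. \<phi> (P (c t))) differentiable at t" if "\<bar>t\<bar> < e" for t
      using der[OF that] by (auto simp: has_vector_derivative_def differentiable_def)
    show "\<phi> (P (c t)) \<in> D" for t
      using \<phi>D PT by blast
    show "f (\<phi> (P (c t))) = f x0" if "\<bar>t\<bar> < e" for t
      using gc[OF that] by (simp add: g_def P_0 \<phi>0)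
  qed
qed

text \<open>Applied both to the measurement map and to the chart. The derivative is affine in
  \<open>x\<close>, so its continuity as an operator-valued map can be checked on basis
  vectors.\<close>

lemma quadratic_map_C1:
  fixes b :: "'a::euclidean_space \<Rightarrow> 'a \<Rightarrow> 'b::euclidean_space"
  assumes b: "bounded_bilinear b" and l: "bounded_linear l"
    and F: "\<And>x. F x = k + l x + b x x"
  obtains F' where "\<And>x. (F has_derivative blinfun_apply (F' x)) (at x)" "continuous_on UNIV F'"
    "\<And>x v. F' x v = l v + (b x v + b v x)"
proof -
  interpret b: bounded_bilinear b by fact
  define F' where "F' x = Blinfun (\<lambda>v. l v + (b x v + b v x))" for x
  have F'_apply: "blinfun_apply (F' x) = (\<lambda>v. l v + (b x v + b v x))" for x
    unfolding F'_def
    by (intro bounded_linear_Blinfun_apply bounded_linear_add l b.bounded_linear_left b.bounded_linear_right)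
  show thesis
  proof
    show "(F has_derivative blinfun_apply (F' x)) (at x)" for x
      unfolding F'_apply F[abs_def]
      by (rule has_derivative_eq_rhs,
          (rule derivative_eq_intros bounded_linear_imp_has_derivative[OF l]
             b.FDERIV refl)+) simp
    show "continuous_on UNIV F'"
    proof (rule continuous_on_blinfun_componentwise)
      show "continuous_on UNIV (\<lambda>x. F' x i)" for i
        unfolding F'_apply
        by (intro continuous_intros linear_continuous_on b.bounded_linear_left b.bounded_linear_right)
    qed
    show "F' x v = l v + (b x v + b v x)" for x v
      by (simp add: F'_apply)
  qed
qed

section \<open>Paths preserving a Gram matrix\<close>

text \<open>The squared length of the defect of a linear relation is a polynomial in the Gram
  matrix, so it vanishes for \<open>v\<close> as soon as it does for \<open>w\<close>.\<close>

lemma linear_relation_of_gram_eq: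
  fixes w v :: "'i \<Rightarrow> 'a::real_inner"
  assumes gram: "\<And>i j. i \<in> I \<Longrightarrow> j \<in> I \<Longrightarrow> v i \<bullet> v j = w i \<bullet> w j"
    and I: "k \<in> I" "J \<subseteq> I"
    and w: "w k = (\<Sum>j\<in>J. c j *\<^sub>R w j)"
  shows "v k = (\<Sum>j\<in>J. c j *\<^sub>R v j)"
proof -
  define n where "n z = z k \<bullet> z k - 2 * (\<Sum>j\<in>J. c j * (z k \<bullet> z j))
      + (\<Sum>i\<in>J. \<Sum>j\<in>J. c j * (c i * (z i \<bullet> z j)))" for z :: "'i \<Rightarrow> 'a"
  have n: "(z k - (\<Sum>j\<in>J. c j *\<^sub>R z j)) \<bullet> (z k - (\<Sum>j\<in>J. c j *\<^sub>R z j)) = n z" for z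
    by (simp add: n_def inner_diff inner_sum_left inner_sum_right inner_commute sum_distrib_left sum_negf)
  have "(\<Sum>j\<in>J. c j * (v k \<bullet> v j)) = (\<Sum>j\<in>J. c j * (w k \<bullet> w j))"
    using gram I by (intro sum.cong) auto
  moreover have "(\<Sum>i\<in>J. \<Sum>j\<in>J. c j * (c i * (v i \<bullet> v j))) = (\<Sum>i\<in>J. \<Sum>j\<in>J. c j * (c i * (w i \<bullet> w j)))"
    using gram I by (intro sum.cong) auto
  ultimately have "n v = n w"
    using gram I by (simp add: n_def)
  also have "n w = 0"
    using n[of w] w by simp
  finally show ?thesis
    using n[of v] by simp
qed

text \<open>Let \<open>P\<close> be the orthogonal projection onto \<open>U\<close>. In blocks for
  \<open>U\<close> and its complement, \<open>A = S0 P\<close> has first column (a, c) with a skew,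
  and second column 0. The matrix with rows (a, -c^T) and (c, 0) is skew and agrees with
  \<open>S0\<close> on \<open>U\<close>; it equals \<open>A - adjoint A - P A\<close>.\<close>

lemma skew_extension:
  fixes S0 :: "real^'d \<Rightarrow> real^'d"
  assumes S0: "linear S0" and U: "subspace U"
    and skew: "\<And>x y. x \<in> U \<Longrightarrow> y \<in> U \<Longrightarrow> S0 x \<bullet> y + x \<bullet> S0 y = 0"
  shows "\<exists>S :: real^'d^'d. transpose S = - S \<and> (\<forall>x\<in>U. S *v x = S0 x)"
proof -
  obtain B where B: "B \<subseteq> U" "pairwise orthogonal B" "\<And>x. x \<in> B \<Longrightarrow> norm x = 1"
    "independent B" "span B = U"
    using orthonormal_basis_subspace[OF U] by metis
  have finB: "finite B"
    using B(4) by (rule independent_imp_finite)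
  define P where "P x = (\<Sum>b\<in>B. (x \<bullet> b) *\<^sub>R b)" for x
  have P: "linear P"
    unfolding P_def by (rule linearI) (simp_all add: inner_add_left scaleR_add_left sum.distrib scaleR_sum_right)
  have PU: "P x \<in> U" for x
    using U B(1) by (auto simp: P_def intro!: subspace_sum subspace_mul)
  have P_sym: "P x \<bullet> y = x \<bullet> P y" for x y
    by (simp add: P_def inner_sum_left inner_sum_right inner_commute mult.commute)
  have P_basis: "P b = b" if "b \<in> B" for b
  proof -
    have "P b = (\<Sum>b'\<in>B. if b' = b then b else 0)"
      unfolding P_def
    proof (rule sum.cong)
      fix b'
      assume "b' \<in> B"
      then show "(b \<bullet> b') *\<^sub>R b' = (if b' = b then b else 0)"
        using B(2,3) that by (auto simp: pairwise_def orthogonal_def dot_square_norm)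
    qed simp
    then show ?thesis
      using that finB by simp
  qed
  have P_id: "P x = x" if "x \<in> U" for x
    using linear_eq_on_span[OF P linear_id, of B x] P_basis that B(5) by simp
  define A where "A x = S0 (P x)" for x
  have A: "linear A"
    using linear_compose[OF P S0] by (simp add: A_def[abs_def] o_def)
  \<comment> \<open>\<open>A - adjoint A\<close> and \<open>P \<circ> A\<close> are both skew; on \<open>U\<close>, \<open>adjoint A + P \<circ> A\<close> vanishes.\<close>
  define T where "T x = A x - adjoint A x - P (A x)" for x
  have T: "linear T"
    unfolding T_def[abs_def]
    using linear_compose_sub[OF linear_compose_sub[OF A adjoint_linear[OF A]] linear_compose[OF A P]]
    by (simp add: o_def)
  have T_inner: "T x \<bullet> y = A x \<bullet> y - x \<bullet> A y - A x \<bullet> P y" for x y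
    by (simp add: T_def inner_diff_left adjoint_works[OF A] P_sym)
      (metis adjoint_works[OF A] inner_commute)
  have T_skew: "T x \<bullet> y = - (x \<bullet> T y)" for x y
  proof -
    have "A x \<bullet> P y + A y \<bullet> P x = 0"
      using skew[OF PU PU, of x y] by (simp add: A_def inner_commute)
    then show ?thesis
      using T_inner[of x y] T_inner[of y x] by (simp add: inner_commute)
  qed
  have T_U: "T x = S0 x" if x: "x \<in> U" for x
  proof -
    have "(T x - S0 x) \<bullet> y = 0" for y
      using T_inner[of x y] skew[OF x PU, of y] by (simp add: inner_diff_left A_def P_id[OF x])
    then show ?thesis
      by (metis inner_eq_zero_iff right_minus_eq)
  qed
  show ?thesis
  proof (intro exI conjI ballI)
    show "transpose (matrix T) = - matrix T"
      unfolding vec_eq_iff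
    proof (intro allI)
      fix i j
      show "transpose (matrix T) $ i $ j = (- matrix T) $ i $ j"
        using T_skew[of "axis i 1" "axis j 1"]
        by (simp add: transpose_def matrix_def inner_axis inner_axis')
    qed
    show "matrix T *v x = S0 x" if "x \<in> U" for x
      using T_U[OF that] matrix_vector_mul(2)[OF T] by metis
  qed
qed

text \<open>
  The Gram matrix is assumed to be preserved along \<open>F\<close> and not only to first order, since
  otherwise \<open>w'\<close> need not respect the linear relations between the \<open>w i\<close> when these do not span.
\<close>

lemma skew_of_gram_preserving:
  fixes w w' :: "'i \<Rightarrow> real^'d" and W :: "real \<Rightarrow> 'i \<Rightarrow> real^'d"
  assumes "F \<noteq> bot"
    and gram: "\<forall>\<^sub>F t in F. \<forall>i\<in>I. \<forall>j\<in>I. W t i \<bullet> W t j = w i \<bullet> w j"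
    and nz: "\<forall>\<^sub>F t in F. t \<noteq> 0"
    and lim: "\<And>i. i \<in> I \<Longrightarrow> ((\<lambda>t. W t i) \<longlongrightarrow> w i) F"
    and lim': "\<And>i. i \<in> I \<Longrightarrow> ((\<lambda>t. (W t i - w i) /\<^sub>R t) \<longlongrightarrow> w' i) F"
  shows "\<exists>S :: real^'d^'d. transpose S = - S \<and> (\<forall>i\<in>I. w' i = S *v w i)"
proof -
  obtain B where B: "B \<subseteq> w ` I" "independent B" "w ` I \<subseteq> span B"
    by (rule maximal_independent_subset)
  have finB: "finite B"
    using B(2) by (rule independent_imp_finite)
  define \<kappa> where "\<kappa> = inv_into I w"
  have \<kappa>: "\<kappa> b \<in> I" "w (\<kappa> b) = b" if "b \<in> B" for b
    using B(1) that by (auto simp: \<kappa>_def inv_into_into f_inv_into_f subset_iff)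
  then have inj: "inj_on \<kappa> B"
    by (metis inj_onI)
  obtain S0 where S0: "linear S0" "\<And>b. b \<in> B \<Longrightarrow> S0 b = w' (\<kappa> b)"
    using linear_independent_extend[OF B(2), of "\<lambda>b. w' (\<kappa> b)"] by blast
  have S0_w: "S0 (w k) = w' k" if k: "k \<in> I" for k
  proof -
    obtain c where c: "w k = (\<Sum>b\<in>B. c b *\<^sub>R b)"
      using B(3) k span_finite[OF finB] by (auto simp: subset_iff)
    define d where "d j = c (w j)" for j
    have wk: "w k = (\<Sum>j\<in>\<kappa> ` B. d j *\<^sub>R w j)"
      unfolding sum.reindex[OF inj] c by (rule sum.cong) (auto simp: d_def \<kappa>)
    \<comment> \<open>A linear relation between the \<open>w i\<close> holds exactly for
      \<open>W t\<close>, hence passes to difference quotients and their limits.\<close>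
    have "\<forall>\<^sub>F t in F. (W t k - w k) /\<^sub>R t = (\<Sum>j\<in>\<kappa> ` B. d j *\<^sub>R ((W t j - w j) /\<^sub>R t))"
      using gram
    proof (rule eventually_mono)
      fix t
      assume "\<forall>i\<in>I. \<forall>j\<in>I. W t i \<bullet> W t j = w i \<bullet> w j"
      then have "W t k = (\<Sum>j\<in>\<kappa> ` B. d j *\<^sub>R W t j)"
        using \<kappa> k by (intro linear_relation_of_gram_eq[OF _ _ _ wk]) auto
      then show "(W t k - w k) /\<^sub>R t = (\<Sum>j\<in>\<kappa> ` B. d j *\<^sub>R ((W t j - w j) /\<^sub>R t))"
        using wk by (simp add: algebra_simps sum_subtractf scaleR_sum_right)
    qed
    moreover have "((\<lambda>t. \<Sum>j\<in>\<kappa> ` B. d j *\<^sub>R ((W t j - w j) /\<^sub>R t)) \<longlongrightarrow> (\<Sum>j\<in>\<kappa> ` B. d j *\<^sub>R w' j)) F"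
      using \<kappa> by (intro tendsto_intros lim') auto
    ultimately have "((\<lambda>t. (W t k - w k) /\<^sub>R t) \<longlongrightarrow> (\<Sum>j\<in>\<kappa> ` B. d j *\<^sub>R w' j)) F"
      by (simp add: tendsto_cong)
    then have "w' k = (\<Sum>j\<in>\<kappa> ` B. d j *\<^sub>R w' j)"
      using tendsto_unique[OF assms(1) lim'[OF k]] by blast
    also have "\<dots> = (\<Sum>b\<in>B. c b *\<^sub>R S0 b)"
      unfolding sum.reindex[OF inj] by (rule sum.cong) (auto simp: d_def \<kappa> S0)
    also have "\<dots> = S0 (w k)"
      using S0(1) by (simp add: c linear_sum linear_cmul)
    finally show ?thesis by simp
  qed
  have skew_w: "S0 (w i) \<bullet> w j + w i \<bullet> S0 (w j) = 0" if ij: "i \<in> I" "j \<in> I" for i j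
  proof -
    \<comment> \<open>The expression is the change of a Gram entry divided by \<open>t\<close>, so
      it is eventually 0 along \<open>F\<close>.\<close>
    have "((\<lambda>t. ((W t i - w i) /\<^sub>R t) \<bullet> W t j + w i \<bullet> ((W t j - w j) /\<^sub>R t)) \<longlongrightarrow> w' i \<bullet> w j + w i \<bullet> w' j) F"
      by (intro tendsto_intros lim lim' ij)
    moreover have "\<forall>\<^sub>F t in F. ((W t i - w i) /\<^sub>R t) \<bullet> W t j + w i \<bullet> ((W t j - w j) /\<^sub>R t) = 0"
      using gram by (rule eventually_mono) (use ij in \<open>simp add: algebra_simps inner_diff_left inner_diff_right\<close>)
    ultimately have "((\<lambda>t. 0) \<longlongrightarrow> w' i \<bullet> w j + w i \<bullet> w' j) F"
      by (rule Lim_transform_eventually)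
    then show ?thesis
      using tendsto_unique[OF assms(1) _ tendsto_const[of 0]] ij by (simp add: S0_w)
  qed
  have skew1: "S0 x \<bullet> w j + x \<bullet> S0 (w j) = 0" if "x \<in> span (w ` I)" "j \<in> I" for x j
    using that(1)
  proof (induction rule: span_induct)
    case base
    show ?case
      using S0(1) by (intro linear_subspace_kernel linearI) (simp_all add: linear_add linear_cmul inner_add_left distrib_left)
  next
    case (step x)
    then show ?case using skew_w that(2) by auto
  qed
  have skew: "S0 x \<bullet> y + x \<bullet> S0 y = 0" if "x \<in> span (w ` I)" "y \<in> span (w ` I)" for x y
    using that(2)
  proof (induction rule: span_induct)
    case base
    show ?case
      using S0(1) by (intro linear_subspace_kernel linearI) (simp_all add: linear_add linear_cmul inner_add_right distrib_left)
  next
    case (step y)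
    then show ?case using skew1 that(1) by auto
  qed
  obtain S :: "real^'d^'d" where "transpose S = - S" "\<forall>x\<in>span (w ` I). S *v x = S0 x"
    using skew_extension[OF S0(1) subspace_span skew] by blast
  then show ?thesis
    using S0_w by (auto intro!: exI[of _ S] simp: span_base)
qed

section \<open>Congruent frameworks\<close>

lemma f_map_eq_iff:
  "f_map G B (q, m) = f_map G B (q', m') \<longleftrightarrow>
    (\<forall>i\<in>pts G. \<forall>j\<in>pts G. {i, j} \<in> edges G \<longrightarrow> (norm (q $ i - q $ j))\<^sup>2 = (norm (q' $ i - q' $ j))\<^sup>2) \<and>
    (\<forall>i\<in>pts G. \<forall>j\<in>hyps G. {i, j} \<in> edges G \<longrightarrow>
      q $ i \<bullet> fst (m $ j) - snd (m $ j) = q' $ i \<bullet> fst (m' $ j) - snd (m' $ j)) \<and>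
    (\<forall>i\<in>hyps G. \<forall>j\<in>hyps G. {i, j} \<in> edges G - B \<longrightarrow>
      fst (m $ i) \<bullet> fst (m $ j) = fst (m' $ i) \<bullet> fst (m' $ j)) \<and>
    (\<forall>j\<in>hyps G. fst (m $ j) \<bullet> fst (m $ j) = fst (m' $ j) \<bullet> fst (m' $ j))"
  unfolding f_map.simps prod.inject vec_eq_iff vec_lambda_beta
  by (intro arg_cong2[of _ _ _ _ "(\<and>)"]) auto

lemma par_edges_iff:
  "{i, j} \<in> par_edges G (p, l) \<longleftrightarrow>
    i \<in> hyps G \<and> j \<in> hyps G \<and> {i, j} \<in> edges G \<and> parallel (fst (l $ i)) (fst (l $ j))"
  by (auto simp: doubleton_eq_iff insert_commute)

lemma parallel_iff:
  assumes "a \<noteq> 0" "b \<noteq> 0"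
  shows "parallel a b \<longleftrightarrow> (\<exists>c. b = c *\<^sub>R a)"
  using assms by (simp add: collinear_lemma)

text \<open>Collinearity with 0 is not transitive through zero vectors. As the normals of a
  framework are non-zero, the induction along parallel edges can carry an explicit factor, and
  factors multiply.\<close>

lemma class_edges_parallel:
  assumes "framework G (p, l)" "{i, j} \<in> class_edges G (p, l)"
  shows "parallel (fst (l $ i)) (fst (l $ j))"
proof -
  have *: "(i, j) \<in> {(u, v). {u, v} \<in> par_edges G (p, l)}\<^sup>* \<Longrightarrow> i \<in> hyps G \<Longrightarrow>
      j \<in> hyps G \<and> (\<exists>c. fst (l $ j) = c *\<^sub>R fst (l $ i))" for i j
  proof (induction rule: rtrancl_induct)
    case base
    then show ?case by (metis scaleR_one)
  next
    case (step j k)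
    then have "{j, k} \<in> par_edges G (p, l)" by simp
    then have "j \<in> hyps G" "k \<in> hyps G" "parallel (fst (l $ j)) (fst (l $ k))"
      unfolding par_edges_iff by auto
    moreover have "\<forall>j\<in>hyps G. fst (l $ j) \<noteq> 0"
      using assms(1) by simp
    ultimately obtain d where "fst (l $ k) = d *\<^sub>R fst (l $ j)"
      using parallel_iff by blast
    moreover obtain c where "fst (l $ j) = c *\<^sub>R fst (l $ i)"
      using step.IH[OF step.prems] by blast
    ultimately have "fst (l $ k) = (d * c) *\<^sub>R fst (l $ i)"
      by simp
    then show ?case
      using \<open>k \<in> hyps G\<close> by blast
  qed
  have "\<exists>i' j'. {i, j} = {i', j'} \<and> i' \<in> hyps G \<and> j' \<in> hyps G \<and> i' \<noteq> j' \<and>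
      (i', j') \<in> {(u, v). {u, v} \<in> par_edges G (p, l)}\<^sup>*"
    using assms(2) by (simp only: class_edges_def mem_Collect_eq)
  then obtain i' j' where ij: "{i, j} = {i', j'}" "i' \<in> hyps G"
      "(i', j') \<in> {(u, v). {u, v} \<in> par_edges G (p, l)}\<^sup>*"
    by (elim exE conjE)
  then have "parallel (fst (l $ i')) (fst (l $ j'))"
    using *[OF ij(3,2)] by (auto simp: collinear_lemma)
  then show ?thesis
    using ij(1) by (auto simp: doubleton_eq_iff insert_commute)
qed

text \<open>The filter is kept general so that limits can be taken along the congruent times
  only.\<close>

lemma tendsto_difference_quotient:
  fixes x :: "real \<Rightarrow> 'a::real_normed_vector"
  assumes "(x has_vector_derivative u) (at 0)" "F \<le> at 0"
  shows "((\<lambda>t. (x t - x 0) /\<^sub>R t) \<longlongrightarrow> u) F"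
proof -
  have "(\<lambda>t. norm (x (0 + t) - x 0 - t *\<^sub>R u) / norm t) \<midarrow>0\<rightarrow> 0"
    using assms(1) by (simp add: has_vector_derivative_def has_derivative_at)
  moreover have "\<forall>\<^sub>F t in at 0. norm (x (0 + t) - x 0 - t *\<^sub>R u) / norm t = norm ((x t - x 0) /\<^sub>R t - u)"
    unfolding eventually_at_filter
  proof (rule always_eventually, intro allI impI)
    fix t :: real
    assume "t \<noteq> 0"
    then have "(x t - x 0) /\<^sub>R t - u = (x t - x 0 - t *\<^sub>R u) /\<^sub>R t"
      by (simp add: scaleR_diff_right)
    then show "norm (x (0 + t) - x 0 - t *\<^sub>R u) / norm t = norm ((x t - x 0) /\<^sub>R t - u)"
      by (simp add: divide_inverse_commute)
  qed
  ultimately have "(\<lambda>t. norm ((x t - x 0) /\<^sub>R t - u)) \<midarrow>0\<rightarrow> 0"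
    by (rule Lim_transform_eventually)
  then have "(\<lambda>t. (x t - x 0) /\<^sub>R t) \<midarrow>0\<rightarrow> u"
    by (rule LIM_zero_cancel[OF tendsto_norm_zero_cancel])
  then show ?thesis
    by (rule tendsto_mono[OF assms(2)])
qed

lemma trivial_motion_of_congruent_path:
  fixes G :: "'w::finite ph_graph" and x :: "real \<Rightarrow> ('d::finite, 'w) config"
  assumes G: "pts G \<noteq> {}" "pts G \<inter> hyps G = {}"
    and fw: "framework G (p, l)"
    and x0: "x 0 = (p, l)" and der: "(x has_vector_derivative u) (at 0)"
    and freq: "\<exists>\<^sub>F t in at_right 0. x t \<in> W_set (complete_on G) (class_edges G (p, l)) \<and>
      f_map (complete_on G) (class_edges G (p, l)) (x t) = f_map (complete_on G) (class_edges G (p, l)) (p, l)"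
  shows "trivial_motion G (p, l) u"
proof -
  define K where "K = complete_on G"
  define C where "C = class_edges G (p, l)"
  define cong where "cong t \<longleftrightarrow> x t \<in> W_set K C \<and> f_map K C (x t) = f_map K C (p, l)" for t
  \<comment> \<open>Positive times tending to 0 at which the path is congruent to the framework.
    That they accumulate at 0 means that this filter is proper, so limits along it are
    unique.\<close>
  define F where "F = inf (at_right (0::real)) (principal {t. cong t})"
  have F: "F \<noteq> bot"
    using freq unfolding F_def cong_def K_def C_def frequently_def
    by (simp add: trivial_limit_def eventually_inf_principal)
  have F_le: "F \<le> at 0"
    unfolding F_def by (rule order_trans[OF inf_le1 at_le]) simp
  have ev_cong: "\<forall>\<^sub>F t in F. cong t"
    unfolding F_def by (simp add: eventually_inf_principal)
  have nz: "\<forall>\<^sub>F t in F. t \<noteq> 0"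
    using F_le by (auto intro: filter_leD simp: eventually_at_filter)
  obtain q0 m0 where u: "u = (q0, m0)"
    by (cases u)
  define q where "q t = fst (x t)" for t
  define m where "m t = snd (x t)" for t
  have K: "pts K = pts G" "hyps K = hyps G"
    by (simp_all add: K_def complete_on_def)
  have x_lim: "(x \<longlongrightarrow> (p, l)) F"
    using tendsto_mono[OF F_le] has_vector_derivative_continuous[OF der] x0
    by (simp add: continuous_at)
  have q_lim: "((\<lambda>t. q t $ i) \<longlongrightarrow> p $ i) F" for i
    unfolding q_def using tendsto_vec_nth[OF tendsto_fst[OF x_lim]] by simp
  have a_lim: "((\<lambda>t. fst (m t $ i)) \<longlongrightarrow> fst (l $ i)) F" for i
    unfolding m_def using tendsto_fst[OF tendsto_vec_nth[OF tendsto_snd[OF x_lim]]] by simp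
  have x_quot: "((\<lambda>t. (x t - (p, l)) /\<^sub>R t) \<longlongrightarrow> u) F"
    using tendsto_difference_quotient[OF der F_le] x0 by simp
  have q_quot: "((\<lambda>t. (q t $ i - p $ i) /\<^sub>R t) \<longlongrightarrow> q0 $ i) F" for i
    using tendsto_vec_nth[OF tendsto_fst[OF x_quot]] by (simp add: q_def u)
  have a_quot: "((\<lambda>t. (fst (m t $ i) - fst (l $ i)) /\<^sub>R t) \<longlongrightarrow> fst (m0 $ i)) F" for i
    using tendsto_fst[OF tendsto_vec_nth[OF tendsto_snd[OF x_quot]]] by (simp add: m_def u)
  have r_quot: "((\<lambda>t. (snd (m t $ i) - snd (l $ i)) /\<^sub>R t) \<longlongrightarrow> snd (m0 $ i)) F" for i
    using tendsto_snd[OF tendsto_vec_nth[OF tendsto_snd[OF x_quot]]] by (simp add: m_def u)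
  have cong_eqs:
    "\<And>i j. i \<in> pts G \<Longrightarrow> j \<in> pts G \<Longrightarrow> (norm (q t $ i - q t $ j))\<^sup>2 = (norm (p $ i - p $ j))\<^sup>2"
    "\<And>i j. i \<in> pts G \<Longrightarrow> j \<in> hyps G \<Longrightarrow>
      q t $ i \<bullet> fst (m t $ j) - snd (m t $ j) = p $ i \<bullet> fst (l $ j) - snd (l $ j)"
    "\<And>i j. i \<in> hyps G \<Longrightarrow> j \<in> hyps G \<Longrightarrow> i \<noteq> j \<Longrightarrow> {i, j} \<notin> C \<Longrightarrow>
      fst (m t $ i) \<bullet> fst (m t $ j) = fst (l $ i) \<bullet> fst (l $ j)"
    "\<And>j. j \<in> hyps G \<Longrightarrow> fst (m t $ j) \<bullet> fst (m t $ j) = fst (l $ j) \<bullet> fst (l $ j)"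
    if "cong t" for t
  proof -
    have "f_map K C (q t, m t) = f_map K C (p, l)"
      using that by (simp add: cong_def q_def m_def)
    note eqs = this[unfolded f_map_eq_iff K]
    have edge: "{i, j} \<in> edges K" if "i \<in> verts G" "j \<in> verts G" "i \<noteq> j" for i j
      unfolding K_def complete_on_def using that by auto
    show "(norm (q t $ i - q t $ j))\<^sup>2 = (norm (p $ i - p $ j))\<^sup>2" if ij: "i \<in> pts G" "j \<in> pts G" for i j
    proof (cases "i = j")
      case False
      then have "{i, j} \<in> edges K"
        using ij by (intro edge) auto
      then show ?thesis
        using eqs ij by blast
    qed simp
    show "q t $ i \<bullet> fst (m t $ j) - snd (m t $ j) = p $ i \<bullet> fst (l $ j) - snd (l $ j)"
      if ij: "i \<in> pts G" "j \<in> hyps G" for i j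
    proof -
      have "{i, j} \<in> edges K"
        using ij G(2) by (intro edge) auto
      then show ?thesis
        using eqs ij by blast
    qed
    show "fst (m t $ i) \<bullet> fst (m t $ j) = fst (l $ i) \<bullet> fst (l $ j)"
      if ij: "i \<in> hyps G" "j \<in> hyps G" "i \<noteq> j" "{i, j} \<notin> C" for i j
    proof -
      have "{i, j} \<in> edges K - C"
        using ij edge[of i j] by auto
      then show ?thesis
        using eqs ij by blast
    qed
    show "fst (m t $ j) \<bullet> fst (m t $ j) = fst (l $ j) \<bullet> fst (l $ j)" if "j \<in> hyps G" for j
      using eqs that by blast
  qed
  \<comment> \<open>For parallel pairs only the absolute value of the inner product is controlled; near the
    framework its sign cannot change.\<close>
  have ev_aa: "\<forall>\<^sub>F t in F. fst (m t $ i) \<bullet> fst (m t $ j) = fst (l $ i) \<bullet> fst (l $ j)"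
    if ij: "i \<in> hyps G" "j \<in> hyps G" for i j
  proof (cases "i \<noteq> j \<and> {i, j} \<in> C")
    case False
    show ?thesis
      using ev_cong
    proof eventually_elim
      case (elim t)
      then show ?case
        using False cong_eqs(3,4)[OF elim] ij by blast
    qed
  next
    case True
    have norm_a: "norm (fst (m t $ k)) = norm (fst (l $ k))" if "cong t" "k \<in> hyps G" for t k
      using cong_eqs(4)[OF that] by (simp add: norm_eq_sqrt_inner)
    have abs_l: "\<bar>fst (l $ i) \<bullet> fst (l $ j)\<bar> = norm (fst (l $ i)) * norm (fst (l $ j))"
      using class_edges_parallel[OF fw] True by (simp add: norm_cauchy_schwarz_equal C_def)
    have abs_eq: "\<bar>fst (m t $ i) \<bullet> fst (m t $ j)\<bar> = \<bar>fst (l $ i) \<bullet> fst (l $ j)\<bar>" if t: "cong t" for t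
    proof -
      have "parallel (fst (m t $ i)) (fst (m t $ j))"
        using t True ij unfolding cong_def W_set_def K m_def by auto
      then show ?thesis
        using abs_l norm_a[OF t] ij by (simp add: norm_cauchy_schwarz_equal[symmetric])
    qed
    have "fst (l $ i) \<bullet> fst (l $ j) \<noteq> 0"
      using abs_l fw ij by auto
    then have "0 < (fst (l $ i) \<bullet> fst (l $ j)) * (fst (l $ i) \<bullet> fst (l $ j))"
      by (simp flip: power2_eq_square)
    moreover have "((\<lambda>t. (fst (m t $ i) \<bullet> fst (m t $ j)) * (fst (l $ i) \<bullet> fst (l $ j))) \<longlongrightarrow>
        (fst (l $ i) \<bullet> fst (l $ j)) * (fst (l $ i) \<bullet> fst (l $ j))) F"
      by (intro tendsto_intros a_lim)
    ultimately have "\<forall>\<^sub>F t in F. 0 < (fst (m t $ i) \<bullet> fst (m t $ j)) * (fst (l $ i) \<bullet> fst (l $ j))"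
      by (rule order_tendstoD(1)[rotated])
    with ev_cong show ?thesis
    proof eventually_elim
      case (elim t)
      then show ?case
        using abs_eq[of t] by (auto simp: abs_if zero_less_mult_iff split: if_splits)
    qed
  qed
  obtain k where k: "k \<in> pts G"
    using G(1) by blast
  \<comment> \<open>Normals, and differences to a base point \<open>k\<close>: vectors unaffected by
    translations, on which congruences act linearly.\<close>
  define vec where "vec y i = (if i \<in> pts G then fst y $ i - fst y $ k else fst (snd y $ i))"
    for y :: "('d, 'w) config" and i
  have vec_x: "vec (x t) i = (if i \<in> pts G then q t $ i - q t $ k else fst (m t $ i))" for t i
    by (simp add: vec_def q_def m_def)
  have vec_pl: "vec (p, l) i = (if i \<in> pts G then p $ i - p $ k else fst (l $ i))" for i
    by (simp add: vec_def)
  have ev_gram: "\<forall>\<^sub>F t in F. vec (x t) i \<bullet> vec (x t) j = vec (p, l) i \<bullet> vec (p, l) j"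
    if ij: "i \<in> verts G" "j \<in> verts G" for i j
  proof -
    have pp: "(q t $ i - q t $ k) \<bullet> (q t $ j - q t $ k) = (p $ i - p $ k) \<bullet> (p $ j - p $ k)"
      if "cong t" "i \<in> pts G" "j \<in> pts G" for t i j
    proof -
      \<comment> \<open>Polarization turns squared distances into inner products.\<close>
      have "2 * ((y $ i - y $ k) \<bullet> (y $ j - y $ k)) =
          (norm (y $ i - y $ k))\<^sup>2 + (norm (y $ j - y $ k))\<^sup>2 - (norm (y $ i - y $ j))\<^sup>2"
        for y :: "(real^'d)^'w"
        by (simp add: power2_norm_eq_inner inner_diff_left inner_diff_right inner_commute)
      then show ?thesis
        using cong_eqs(1)[OF that(1)] that k by (smt (verit))
    qed
    \<comment> \<open>Subtracting the measurement of \<open>k\<close> cancels the scalar component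
      of the hyperplane.\<close>
    have ph: "(q t $ i - q t $ k) \<bullet> fst (m t $ j) = (p $ i - p $ k) \<bullet> fst (l $ j)"
      if "cong t" "i \<in> pts G" "j \<in> hyps G" for t i j
      using cong_eqs(2)[OF that] cong_eqs(2)[OF that(1) k that(3)] by (simp add: inner_diff_left)
    consider "i \<in> pts G" "j \<in> pts G" | "i \<in> pts G" "j \<in> hyps G" "j \<notin> pts G"
      | "i \<in> hyps G" "i \<notin> pts G" "j \<in> pts G" | "i \<in> hyps G" "i \<notin> pts G" "j \<in> hyps G" "j \<notin> pts G"
      using ij by blast
    then show ?thesis
    proof cases
      case 1
      show ?thesis
        using ev_cong by eventually_elim (use pp 1 in \<open>simp add: vec_x vec_pl\<close>)
    next
      case 2
      show ?thesis
        using ev_cong by eventually_elim (use ph 2 in \<open>simp add: vec_x vec_pl\<close>)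
    next
      case 3
      show ?thesis
        using ev_cong by eventually_elim (use ph 3 in \<open>simp add: vec_x vec_pl inner_commute\<close>)
    next
      case 4
      then show ?thesis
        using ev_aa by (simp add: vec_x vec_pl)
    qed
  qed
  have vec_quot: "((\<lambda>t. (vec (x t) i - vec (p, l) i) /\<^sub>R t) \<longlongrightarrow> vec u i) F" for i
  proof (cases "i \<in> pts G")
    case True
    then show ?thesis
      using tendsto_diff[OF q_quot q_quot, of i k]
      unfolding vec_x vec_pl by (simp add: vec_def u algebra_simps)
  next
    case False
    then show ?thesis
      using a_quot[of i] unfolding vec_x vec_pl by (simp add: vec_def u)
  qed
  have vec_lim: "((\<lambda>t. vec (x t) i) \<longlongrightarrow> vec (p, l) i) F" for i
    unfolding vec_x vec_pl using q_lim a_lim by (auto intro!: tendsto_diff)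
  have "\<forall>\<^sub>F t in F. \<forall>i\<in>verts G. \<forall>j\<in>verts G. vec (x t) i \<bullet> vec (x t) j = vec (p, l) i \<bullet> vec (p, l) j"
    using ev_gram by (intro eventually_ball_finite ballI) auto
  then obtain S :: "real^'d^'d" where S: "transpose S = - S"
    and vec_S: "\<And>i. i \<in> verts G \<Longrightarrow> vec u i = S *v vec (p, l) i"
    using skew_of_gram_preserving[of F "verts G" "\<lambda>t. vec (x t)" "vec (p, l)" "vec u", OF F _ nz vec_lim vec_quot]
    by blast
  \<comment> \<open>The translation is read off at \<open>k\<close>, where \<open>vec\<close>
    vanishes.\<close>
  define b where "b = q0 $ k - S *v p $ k"
  have q0: "q0 $ i = S *v p $ i + b" if "i \<in> pts G" for i
    using vec_S[of i] that by (simp add: vec_def u b_def algebra_simps matrix_vector_mult_diff_distrib)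
  have a0: "fst (m0 $ j) = S *v fst (l $ j)" if "j \<in> hyps G" for j
  proof -
    have "j \<notin> pts G"
      using that G(2) by blast
    then show ?thesis
      using vec_S[of j] that by (simp add: vec_def u)
  qed
  have r0: "snd (m0 $ j) = b \<bullet> fst (l $ j)" if j: "j \<in> hyps G" for j
  proof -
    \<comment> \<open>The scalar components do not enter \<open>vec\<close>; they are recovered by
      differentiating the measurement between \<open>k\<close> and the hyperplane.\<close>
    have "((\<lambda>t. ((q t $ k - p $ k) /\<^sub>R t) \<bullet> fst (m t $ j) + p $ k \<bullet> ((fst (m t $ j) - fst (l $ j)) /\<^sub>R t)
        - (snd (m t $ j) - snd (l $ j)) /\<^sub>R t) \<longlongrightarrow>
        q0 $ k \<bullet> fst (l $ j) + p $ k \<bullet> fst (m0 $ j) - snd (m0 $ j)) F"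
      by (intro tendsto_intros q_quot a_quot r_quot a_lim)
    moreover have "\<forall>\<^sub>F t in F. ((q t $ k - p $ k) /\<^sub>R t) \<bullet> fst (m t $ j) +
        p $ k \<bullet> ((fst (m t $ j) - fst (l $ j)) /\<^sub>R t) - (snd (m t $ j) - snd (l $ j)) /\<^sub>R t = 0"
      using ev_cong
    proof eventually_elim
      case (elim t)
      have "((q t $ k - p $ k) /\<^sub>R t) \<bullet> fst (m t $ j) +
        p $ k \<bullet> ((fst (m t $ j) - fst (l $ j)) /\<^sub>R t) - (snd (m t $ j) - snd (l $ j)) /\<^sub>R t =
        ((q t $ k \<bullet> fst (m t $ j) - snd (m t $ j)) - (p $ k \<bullet> fst (l $ j) - snd (l $ j))) /\<^sub>R t"
        by (simp add: inner_diff_left inner_diff_right algebra_simps)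
      then show ?case
        using cong_eqs(2)[OF elim k j] by simp
    qed
    ultimately have "((\<lambda>t. 0) \<longlongrightarrow> q0 $ k \<bullet> fst (l $ j) + p $ k \<bullet> fst (m0 $ j) - snd (m0 $ j)) F"
      by (rule Lim_transform_eventually)
    then have "q0 $ k \<bullet> fst (l $ j) + p $ k \<bullet> fst (m0 $ j) - snd (m0 $ j) = 0"
      using tendsto_unique[OF F _ tendsto_const[of 0]] by blast
    moreover have "p $ k \<bullet> (S *v fst (l $ j)) = - ((S *v p $ k) \<bullet> fst (l $ j))"
    proof -
      have "p $ k \<bullet> (S *v fst (l $ j)) = (transpose S *v p $ k) \<bullet> fst (l $ j)"
        by (simp add: dot_lmul_matrix)
      moreover have "(- S) *v p $ k = - (S *v p $ k)"
        by (simp add: matrix_vector_mult_def vec_eq_iff sum_negf)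
      ultimately show ?thesis
        by (simp add: S)
    qed
    ultimately show ?thesis
      using a0[OF j] q0[OF k] by (simp add: inner_add_left)
  qed
  have "m0 $ j = (S *v fst (l $ j), b \<bullet> fst (l $ j))" if "j \<in> hyps G" for j
    using a0[OF that] r0[OF that] by (simp add: prod_eq_iff)
  then show ?thesis
    unfolding u trivial_motion.simps using S q0 by blast
qed

section \<open>The measurement map and symmetric vectors\<close>

definition f_lin :: "'v::finite ph_graph \<Rightarrow> ('d::finite, 'v) config \<Rightarrow>
    (real^'v^'v) \<times> (real^'v^'v) \<times> (real^'v^'v) \<times> (real^'v)"
  where "f_lin G x =
    (0, \<chi> i j. if i \<in> pts G \<and> j \<in> hyps G \<and> {i, j} \<in> edges G then - snd (snd x $ j) else 0, 0, 0)"

text \<open>The form is not symmetrized, so the derivative of the quadratic part at \<open>x\<close>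
  adds both orders of the arguments.\<close>

definition f_bil :: "'v::finite ph_graph \<Rightarrow> 'v set set \<Rightarrow> ('d::finite, 'v) config \<Rightarrow> ('d, 'v) config \<Rightarrow>
    (real^'v^'v) \<times> (real^'v^'v) \<times> (real^'v^'v) \<times> (real^'v)"
  where "f_bil G B x y =
    (\<chi> i j. if i \<in> pts G \<and> j \<in> pts G \<and> {i, j} \<in> edges G
            then (fst x $ i - fst x $ j) \<bullet> (fst y $ i - fst y $ j) else 0,
     \<chi> i j. if i \<in> pts G \<and> j \<in> hyps G \<and> {i, j} \<in> edges G
            then fst x $ i \<bullet> fst (snd y $ j) else 0,
     \<chi> i j. if i \<in> hyps G \<and> j \<in> hyps G \<and> {i, j} \<in> edges G - B
            then fst (snd x $ i) \<bullet> fst (snd y $ j) else 0,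
     \<chi> j. if j \<in> hyps G then fst (snd x $ j) \<bullet> fst (snd y $ j) else 0)"

lemma f_map_quadratic: "f_map G B x = 0 + f_lin G x + f_bil G B x x"
  by (cases x) (simp add: f_lin_def f_bil_def vec_eq_iff power2_norm_eq_inner)

lemma bounded_linear_f_lin: "bounded_linear (f_lin G)"
  unfolding linear_conv_bounded_linear[symmetric]
  by (rule linearI) (simp_all add: f_lin_def vec_eq_iff)

lemma bounded_bilinear_f_bil: "bounded_bilinear (f_bil G B)"
  unfolding bilinear_conv_bounded_bilinear[symmetric] bilinear_def
  by (intro conjI allI; rule linearI)
    (simp_all add: f_bil_def vec_eq_iff inner_add_left inner_add_right inner_diff_left inner_diff_right
      algebra_simps)

lemma f_map_derivative_infinitesimal_motion:
  assumes "infinitesimal_motion G pl u"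
  shows "f_lin G u + (f_bil G (par_edges G pl) pl u + f_bil G (par_edges G pl) u pl) = 0"
proof -
  obtain p l q m where [simp]: "pl = (p, l)" "u = (q, m)"
    by (cases pl, cases u)
  from assms show ?thesis
    by (simp add: f_lin_def f_bil_def vec_eq_iff zero_prod_def inner_commute del: par_edges.simps)
qed

section \<open>The group action and the external representation\<close>

lemma act_act [simp]: "act \<gamma> (act \<gamma> i) = i"
proof (cases i)
  case (Pair u e)
  have "x + \<gamma> $ h + \<gamma> $ h = x" for x h
    by (cases "\<gamma> $ h = 0"; cases "x = 0") auto
  then show ?thesis
    unfolding Pair act.simps vec_lambda_beta option.map_comp o_def
    by (simp only: option.map_ident vec_nth_inverse)
qed

text \<open>The cochain whose coboundary is \<^const>\<open>shift\<close>.\<close>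

definition offset :: "('t::finite \<Rightarrow> real^'d::finite) \<Rightarrow> 'v \<times> ((bit option)^'t) \<Rightarrow> real^'d"
  where "offset \<tau> i = (\<Sum>h | snd i $ h = Some 1. \<tau> h)"

lemma shift_eq_offset_diff: "shift \<tau> \<gamma> i = offset \<tau> (act \<gamma> i) - offset \<tau> i"
proof -
  obtain u e where i: "i = (u, e)"
    by (cases i)
  \<comment> \<open>Coordinates changing from 0 to 1 (\<open>X\<close>), from 1 to 0
    (\<open>Y\<close>) and staying at 1 (\<open>Z\<close>); the sum over \<open>Z\<close> cancels in
    the difference of offsets.\<close>
  define X where "X = {h. e $ h = Some 0 \<and> \<gamma> $ h = 1}"
  define Y where "Y = {h. e $ h = Some 1 \<and> \<gamma> $ h = 1}"
  define Z where "Z = {h. e $ h = Some 1 \<and> \<gamma> $ h = 0}"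
  have new: "{h. map_option (\<lambda>b. b + \<gamma> $ h) (e $ h) = Some 1} = X \<union> Z"
  proof (rule set_eqI)
    fix h
    show "h \<in> {h. map_option (\<lambda>b. b + \<gamma> $ h) (e $ h) = Some 1} \<longleftrightarrow> h \<in> X \<union> Z"
      by (cases "e $ h"; cases "\<gamma> $ h = 0"; cases "the (e $ h) = 0") (auto simp: X_def Z_def)
  qed
  have old: "{h. e $ h = Some 1} = Y \<union> Z"
    by (auto simp: Y_def Z_def)
  have "sum \<tau> (X \<union> Z) = sum \<tau> X + sum \<tau> Z" "sum \<tau> (Y \<union> Z) = sum \<tau> Y + sum \<tau> Z"
    by (rule sum.union_disjoint; auto simp: X_def Y_def Z_def)+
  then show ?thesis
    unfolding i offset_def act.simps shift.simps snd_conv vec_lambda_beta new old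
      X_def[symmetric] Y_def[symmetric]
    by simp
qed

text \<open>As \<open>act \<gamma>\<close> is an involution, the only non-zero block in row
  \<open>i\<close> is in column \<open>act \<gamma> i\<close>, so the sums collapse.\<close>

lemma symmetric_vectors_iff:
  assumes pts: "\<forall>\<gamma>. \<forall>i\<in>pts G. act \<gamma> i \<in> pts G"
    and hyps: "\<forall>\<gamma>. \<forall>i\<in>hyps G. act \<gamma> i \<in> hyps G"
  shows "u \<in> symmetric_vectors G \<tau> \<rho> \<longleftrightarrow> u \<in> config_space G \<and>
    (\<forall>\<gamma>. (\<forall>i\<in>pts G. fst u $ act \<gamma> i = \<rho> \<gamma> *\<^sub>R fst u $ i) \<and>
      (\<forall>i\<in>hyps G. fst (snd u $ act \<gamma> i) = \<rho> \<gamma> *\<^sub>R fst (snd u $ i) \<and>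
        snd (snd u $ act \<gamma> i) - shift \<tau> \<gamma> i \<bullet> fst (snd u $ act \<gamma> i) = \<rho> \<gamma> * snd (snd u $ i)))"
proof (cases u)
  case (Pair q m)
  have act_iff: "i = act \<gamma> j \<longleftrightarrow> j = act \<gamma> i" for i j \<gamma>
    by (metis act_act)
  have iff: "act \<gamma> i \<in> pts G \<longleftrightarrow> i \<in> pts G" "act \<gamma> i \<in> hyps G \<longleftrightarrow> i \<in> hyps G" for \<gamma> i
    by (metis act_act pts, metis act_act hyps)
  have ext: "ext_rep G \<tau> \<gamma> (q, m) =
      (\<chi> i. if i \<in> pts G then q $ act \<gamma> i else 0,
       \<chi> i. if i \<in> hyps G then (fst (m $ act \<gamma> i),
          - (shift \<tau> \<gamma> i \<bullet> fst (m $ act \<gamma> i)) + snd (m $ act \<gamma> i)) else 0)" for \<gamma>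
    unfolding ext_rep.simps by (subst (1 2) act_iff) (simp add: iff sum.delta)
  show ?thesis
    unfolding Pair symmetric_vectors_def mem_Collect_eq ext
    by (auto simp: vec_eq_iff prod_eq_iff config_space_def simp del: split_paired_All act.simps split: if_splits)
qed

lemma subspace_symmetric_vectors:
  assumes pts: "\<forall>\<gamma>. \<forall>i\<in>pts G. act \<gamma> i \<in> pts G"
    and hyps: "\<forall>\<gamma>. \<forall>i\<in>hyps G. act \<gamma> i \<in> hyps G"
  shows "subspace (symmetric_vectors G \<tau> \<rho>)"
  by (auto simp: subspace_def symmetric_vectors_iff[OF pts hyps] config_space_def zero_prod_def
      scaleR_add_right inner_add_right algebra_simps simp del: act.simps shift.simps split_paired_All)

section \<open>Tangent vectors of the constrained configurations\<close>

text \<open>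
  The vectors of \<open>X\<close> satisfying the linearized parallelism constraints of \<^const>\<open>W_set\<close>, in the form
  in which they occur in \<^const>\<open>infinitesimal_motion\<close>.
\<close>

definition tangent_vectors ::
    "('d::finite, 'v::finite) config set \<Rightarrow> 'v ph_graph \<Rightarrow> ('d, 'v) config \<Rightarrow> ('d, 'v) config set"
  where "tangent_vectors X G x = {v \<in> X. \<forall>i\<in>hyps G. \<forall>j\<in>hyps G. {i, j} \<in> par_edges G x \<longrightarrow>
    (\<forall>c. fst (snd x $ j) = c *\<^sub>R fst (snd x $ i) \<longrightarrow>
      (\<forall>\<alpha>. \<alpha> \<bullet> fst (snd x $ i) = 0 \<longrightarrow> (c *\<^sub>R fst (snd v $ i) - fst (snd v $ j)) \<bullet> \<alpha> = 0))}"

lemma tangent_vectors_mem: "v \<in> tangent_vectors X G x \<Longrightarrow> v \<in> X"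
  by (simp only: tangent_vectors_def mem_Collect_eq)

lemma tangent_vectorsD:
  assumes "v \<in> tangent_vectors X G x" "i \<in> hyps G" "j \<in> hyps G" "{i, j} \<in> par_edges G x"
    "fst (snd x $ j) = c *\<^sub>R fst (snd x $ i)" "\<alpha> \<bullet> fst (snd x $ i) = 0"
  shows "(c *\<^sub>R fst (snd v $ i) - fst (snd v $ j)) \<bullet> \<alpha> = 0"
  using assms unfolding tangent_vectors_def by blast

lemma subspace_tangent_vectors:
  assumes X: "subspace X"
  shows "subspace (tangent_vectors X G x)"
proof (rule subspaceI)
  show "0 \<in> tangent_vectors X G x"
    using subspace_0[OF X] by (simp add: tangent_vectors_def)
next
  fix v w
  assume vw: "v \<in> tangent_vectors X G x" "w \<in> tangent_vectors X G x"
  have "(c *\<^sub>R fst (snd (v + w) $ i) - fst (snd (v + w) $ j)) \<bullet> \<alpha> = 0"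
    if "i \<in> hyps G" "j \<in> hyps G" "{i, j} \<in> par_edges G x" "fst (snd x $ j) = c *\<^sub>R fst (snd x $ i)"
      "\<alpha> \<bullet> fst (snd x $ i) = 0" for i j c \<alpha>
    using tangent_vectorsD[OF vw(1) that] tangent_vectorsD[OF vw(2) that]
    by (simp add: inner_diff_left inner_add_left distrib_left scaleR_add_right)
  moreover have "v + w \<in> X"
    using vw subspace_add[OF X] by (simp add: tangent_vectors_def)
  ultimately show "v + w \<in> tangent_vectors X G x"
    unfolding tangent_vectors_def by blast
next
  fix r v
  assume v: "v \<in> tangent_vectors X G x"
  have "(c *\<^sub>R fst (snd (r *\<^sub>R v) $ i) - fst (snd (r *\<^sub>R v) $ j)) \<bullet> \<alpha> = 0"
    if "i \<in> hyps G" "j \<in> hyps G" "{i, j} \<in> par_edges G x" "fst (snd x $ j) = c *\<^sub>R fst (snd x $ i)"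
      "\<alpha> \<bullet> fst (snd x $ i) = 0" for i j c \<alpha>
  proof -
    have "(c *\<^sub>R fst (snd (r *\<^sub>R v) $ i) - fst (snd (r *\<^sub>R v) $ j)) \<bullet> \<alpha> =
        r * ((c *\<^sub>R fst (snd v $ i) - fst (snd v $ j)) \<bullet> \<alpha>)"
      by (simp add: inner_diff_left algebra_simps)
    then show ?thesis
      using tangent_vectorsD[OF v that] by simp
  qed
  moreover have "r *\<^sub>R v \<in> X"
    using v subspace_scale[OF X] by (simp add: tangent_vectors_def)
  ultimately show "r *\<^sub>R v \<in> tangent_vectors X G x"
    unfolding tangent_vectors_def by blast
qed

text \<open>The vanishing 2x2 minors of \<open>a\<close> and \<open>b\<close>, paired with test
  vectors: a polynomial form of parallelism that can be differentiated without following a scalar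
  factor along a curve.\<close>

lemma parallel_inner_identity:
  assumes "parallel a b"
  shows "(b \<bullet> \<alpha>) * (a \<bullet> \<beta>) = (a \<bullet> \<alpha>) * (b \<bullet> \<beta>)"
  using assms by (auto simp: collinear_lemma)

lemma config_space_add: "x \<in> config_space G \<Longrightarrow> y \<in> config_space G \<Longrightarrow> x + y \<in> config_space G"
  by (simp add: config_space_def case_prod_unfold)

lemma W_setD:
  assumes "x \<in> W_set G B" "i \<in> hyps G" "j \<in> hyps G" "{i, j} \<in> B"
  shows "parallel (fst (snd x $ i)) (fst (snd x $ j))"
  using assms by (simp add: W_set_def case_prod_unfold)

lemma mem_W_setI:
  assumes "x \<in> config_space G"
    and "\<And>i j. i \<in> hyps G \<Longrightarrow> j \<in> hyps G \<Longrightarrow> {i, j} \<in> B \<Longrightarrow> parallel (fst (snd x $ i)) (fst (snd x $ j))"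
  shows "x \<in> W_set G B"
  using assms by (simp add: W_set_def case_prod_unfold)

text \<open>The difference quotients lie in the closed subspace \<open>X\<close>, and
  differentiating the vanishing minors gives the linearized parallelism.\<close>

lemma tangent_space_subset_tangent_vectors:
  assumes X: "subspace X" and fw: "framework G x"
  shows "tangent_space ((\<lambda>u. x + u) ` X \<inter> W_set G (par_edges G x)) x \<subseteq> tangent_vectors X G x"
proof
  fix v
  assume "v \<in> tangent_space ((\<lambda>u. x + u) ` X \<inter> W_set G (par_edges G x)) x"
  then obtain c where c0: "c 0 = x" and der: "(c has_vector_derivative v) (at 0)"
    and ev: "\<forall>\<^sub>F s in nhds 0. c s \<in> (\<lambda>u. x + u) ` X \<inter> W_set G (par_edges G x)"
    unfolding tangent_space_def by auto
  have "\<forall>\<^sub>F s in at 0. (c s - c 0) /\<^sub>R s \<in> X"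
    unfolding eventually_at_filter
    using ev
  proof eventually_elim
    case (elim s)
    then show ?case
      using subspace_scale[OF X] c0 by auto
  qed
  then have vX: "v \<in> X"
    by (rule Lim_in_closed_set[OF closed_subspace[OF X] _ _ tendsto_difference_quotient[OF der order_refl]]) simp
  have "(k *\<^sub>R fst (snd v $ i) - fst (snd v $ j)) \<bullet> \<alpha> = 0"
    if ij: "i \<in> hyps G" "j \<in> hyps G" "{i, j} \<in> par_edges G x" and k: "fst (snd x $ j) = k *\<^sub>R fst (snd x $ i)"
      and \<alpha>: "\<alpha> \<bullet> fst (snd x $ i) = 0" for i j k \<alpha>
  proof -
    define a where "a s i = fst (snd (c s) $ i)" for s i
    define \<beta> where "\<beta> = fst (snd x $ i)"
    have \<beta>: "\<beta> \<bullet> \<beta> \<noteq> 0"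
      using fw ij by (cases x) (auto simp: \<beta>_def)
    have dera: "((\<lambda>s. a s i \<bullet> \<gamma>) has_real_derivative fst (snd v $ i) \<bullet> \<gamma>) (at 0)" for i \<gamma>
    proof -
      have "bounded_linear (\<lambda>y :: ('a, 'b) config. fst (snd y $ i) \<bullet> \<gamma>)"
        by (rule bounded_linear_compose[OF bounded_linear_inner_left bounded_linear_compose[OF bounded_linear_fst
              bounded_linear_compose[OF bounded_linear_vec_nth bounded_linear_snd]]])
      from bounded_linear.has_vector_derivative[OF this der] show ?thesis
        by (simp add: a_def has_real_derivative_iff_has_vector_derivative)
    qed
    \<comment> \<open>\<open>\<psi>\<close> vanishes identically by parallelism; its derivative at \<open>0\<close> is the claim times \<open>\<beta> \<bullet> \<beta>\<close>.\<close>
    define \<psi> where "\<psi> s = (a s j \<bullet> \<alpha>) * (a s i \<bullet> \<beta>) - (a s i \<bullet> \<alpha>) * (a s j \<bullet> \<beta>)" for s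
    have "(\<psi> has_real_derivative (fst (snd v $ j) \<bullet> \<alpha>) * (a 0 i \<bullet> \<beta>) + (fst (snd v $ i) \<bullet> \<beta>) * (a 0 j \<bullet> \<alpha>) -
        ((fst (snd v $ i) \<bullet> \<alpha>) * (a 0 j \<bullet> \<beta>) + (fst (snd v $ j) \<bullet> \<beta>) * (a 0 i \<bullet> \<alpha>))) (at 0)"
      unfolding \<psi>_def by (intro DERIV_diff DERIV_mult dera)
    moreover have "\<forall>\<^sub>F s in nhds 0. \<psi> s = 0"
      using ev
    proof eventually_elim
      case (elim s)
      then have "parallel (a s i) (a s j)"
        using W_setD[of "c s" G "par_edges G x" i j] ij unfolding a_def by blast
      then show ?case
        using parallel_inner_identity[of "a s i" "a s j" \<alpha> \<beta>] by (simp add: \<psi>_def)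
    qed
    then have "(\<psi> has_real_derivative 0) (at 0)"
      using DERIV_cong_ev[OF refl, of \<psi> "\<lambda>_. 0" 0 0] by simp
    ultimately have "(fst (snd v $ j) \<bullet> \<alpha>) * (a 0 i \<bullet> \<beta>) + (fst (snd v $ i) \<bullet> \<beta>) * (a 0 j \<bullet> \<alpha>) -
        ((fst (snd v $ i) \<bullet> \<alpha>) * (a 0 j \<bullet> \<beta>) + (fst (snd v $ j) \<bullet> \<beta>) * (a 0 i \<bullet> \<alpha>)) = 0"
      by (rule DERIV_unique)
    moreover have "a 0 i = \<beta>" "a 0 j = k *\<^sub>R \<beta>" "\<beta> \<bullet> \<alpha> = 0"
      using c0 k \<alpha> by (simp_all add: a_def \<beta>_def inner_commute)
    ultimately have "(fst (snd v $ j) \<bullet> \<alpha> - k * (fst (snd v $ i) \<bullet> \<alpha>)) * (\<beta> \<bullet> \<beta>) = 0"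
      by (simp add: algebra_simps)
    then show ?thesis
      using \<beta> by (simp add: inner_diff_left)
  qed
  then show "v \<in> tangent_vectors X G x"
    unfolding tangent_vectors_def using vX by blast
qed

lemma infinitesimal_motion_tangent_vectors:
  assumes "infinitesimal_motion G x u" "u \<in> X"
  shows "u \<in> tangent_vectors X G x"
  using assms by (cases x; cases u) (simp add: tangent_vectors_def del: par_edges.simps)

lemma eq_scaleR_of_orthogonal:
  fixes a v :: "'a::real_inner"
  assumes "\<And>\<alpha>. \<alpha> \<bullet> a = 0 \<Longrightarrow> v \<bullet> \<alpha> = 0"
  shows "v = ((v \<bullet> a) / (a \<bullet> a)) *\<^sub>R a"
proof -
  define r where "r = v - ((v \<bullet> a) / (a \<bullet> a)) *\<^sub>R a"
  have "r \<bullet> a = 0"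
    by (cases "a = 0") (simp_all add: r_def inner_diff_left)
  then have "v \<bullet> r = 0" "a \<bullet> r = 0"
    using assms by (auto simp: inner_commute)
  then have "r \<bullet> r = 0"
    by (simp add: r_def inner_diff_left)
  then show ?thesis
    by (simp add: r_def)
qed

text \<open>The scalar \<open>s\<close> is the first-order change of the factor between the two
  normals.\<close>

lemma tangent_vectors_scaled:
  assumes v: "v \<in> tangent_vectors X G x" and ij: "i \<in> hyps G" "j \<in> hyps G" "{i, j} \<in> par_edges G x"
    and c: "fst (snd x $ j) = c *\<^sub>R fst (snd x $ i)"
  obtains s where "fst (snd v $ j) = c *\<^sub>R fst (snd v $ i) + s *\<^sub>R fst (snd x $ i)"
proof -
  define w where "w = fst (snd v $ j) - c *\<^sub>R fst (snd v $ i)"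
  have "w \<bullet> \<alpha> = 0" if "\<alpha> \<bullet> fst (snd x $ i) = 0" for \<alpha>
    using tangent_vectorsD[OF v ij c that] by (simp add: w_def inner_diff_left)
  from eq_scaleR_of_orthogonal[OF this] that show thesis
    unfolding w_def by (metis diff_add_cancel add.commute)
qed

lemma parallel_scaleR: "parallel (c *\<^sub>R a) (d *\<^sub>R a)"
  by (auto simp: collinear_lemma intro!: exI[of _ "d / c"])

section \<open>Parametrization by tangent vectors\<close>

lemma config_space_framework: "framework G (p, l) \<Longrightarrow> (p, l) \<in> config_space G"
  by simp

text \<open>
  In each class of hyperplanes that are linked by parallel edges or by the action choose a
  representative \<open>k\<close>, so that \<open>a\<^sub>j = c\<^sub>j a\<^sub>k\<close> and a tangent vector has \<open>v\<^sub>j = c\<^sub>j v\<^sub>k + s\<^sub>j(v) a\<^sub>k\<close>. The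
  quadratic term \<open>s\<^sub>j(v) v\<^sub>k\<close> completes \<open>a\<^sub>j + v\<^sub>j\<close> to \<open>(c\<^sub>j + s\<^sub>j(v)) (a\<^sub>k + v\<^sub>k)\<close>; its component for
  \<open>r\<^sub>j\<close> is the one that makes it a symmetric vector.
\<close>

lemma chart_trivial_representation:
  fixes G :: "('v::finite \<times> ((bit option)^'t::finite)) ph_graph"
    and p :: "(real^'d::finite)^('v \<times> ((bit option)^'t))"
  assumes closed: "\<forall>\<gamma>. \<forall>i\<in>pts G. act \<gamma> i \<in> pts G" "\<forall>\<gamma>. \<forall>i\<in>hyps G. act \<gamma> i \<in> hyps G"
    and fw: "framework G (p, l)"
    and inv: "\<And>\<gamma> j. j \<in> hyps G \<Longrightarrow> fst (l $ act \<gamma> j) = fst (l $ j)"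
    and \<rho>: "\<And>\<gamma>. \<rho> \<gamma> = 1"
  shows "\<exists>b. bounded_bilinear b \<and> (\<forall>v\<in>tangent_vectors (symmetric_vectors G \<tau> \<rho>) G (p, l).
    (p, l) + v + b v v \<in> (\<lambda>u. (p, l) + u) ` symmetric_vectors G \<tau> \<rho> \<inter> W_set G (par_edges G (p, l)))"
proof -
  define X where "X = symmetric_vectors G \<tau> \<rho>"
  define T where "T = tangent_vectors X G (p, l)"
  note X_iff = symmetric_vectors_iff[OF closed, where \<tau> = \<tau> and \<rho> = \<rho>, folded X_def]
  have subX: "subspace X"
    unfolding X_def by (rule subspace_symmetric_vectors[OF closed])
  define a where "a j = fst (l $ j)" for j
  have a_nz: "a j \<noteq> 0" if "j \<in> hyps G" for j
    using fw that by (simp add: a_def)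
  \<comment> \<open>Orbits are included so that representatives and scalar factors are constant on
    them, which makes the quadratic term symmetric.\<close>
  define R where "R = {(i, j). i \<in> hyps G \<and> j \<in> hyps G \<and> ({i, j} \<in> par_edges G (p, l) \<or> (\<exists>\<gamma>. j = act \<gamma> i))}"
  have R_iff: "(i, j) \<in> R \<longleftrightarrow> i \<in> hyps G \<and> j \<in> hyps G \<and>
      ({i, j} \<in> par_edges G (p, l) \<or> (\<exists>\<gamma>. j = act \<gamma> i))" for i j
    by (simp only: R_def mem_Collect_eq case_prod_conv)
  have "sym R"
  proof (rule symI)
    fix i j
    assume ij: "(i, j) \<in> R"
    have "i = act \<gamma> j" if "j = act \<gamma> i" for \<gamma>
      by (simp only: that act_act)
    then show "(j, i) \<in> R"
      using ij unfolding R_iff insert_commute[of j i] by blast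
  qed
  then have symE: "(j, i) \<in> R\<^sup>*" if "(i, j) \<in> R\<^sup>*" for i j
    using symD[OF sym_rtrancl that] by blast
  define k where "k j = (SOME i. (j, i) \<in> R\<^sup>*)" for j
  have k: "(j, k j) \<in> R\<^sup>*" for j
    unfolding k_def by (rule someI[of _ j]) simp
  have k_eq: "k i = k j" if "(i, j) \<in> R" for i j
  proof -
    have "(i, x) \<in> R\<^sup>* \<longleftrightarrow> (j, x) \<in> R\<^sup>*" for x
      using rtrancl_trans[OF r_into_rtrancl[OF that]] rtrancl_trans[OF symE[OF r_into_rtrancl[OF that]]] by blast
    then show ?thesis
      by (simp add: k_def)
  qed
  have R_hyps: "j \<in> hyps G" if "(i, j) \<in> R\<^sup>*" "i \<in> hyps G" for i j
    using that by (induction rule: rtrancl_induct) (simp_all only: R_iff)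
  have related: "\<exists>c s. a j = c *\<^sub>R a i \<and> fst (snd v $ j) = c *\<^sub>R fst (snd v $ i) + s *\<^sub>R a i"
    if v: "v \<in> T" and "(i, j) \<in> R\<^sup>*" for v i j
    using that(2)
  proof (induction rule: rtrancl_induct)
    case base
    have "a i = 1 *\<^sub>R a i \<and> fst (snd v $ i) = 1 *\<^sub>R fst (snd v $ i) + 0 *\<^sub>R a i"
      by simp
    then show ?case by blast
  next
    case (step j m)
    then obtain c s where c: "a j = c *\<^sub>R a i" and s: "fst (snd v $ j) = c *\<^sub>R fst (snd v $ i) + s *\<^sub>R a i"
      by blast
    have jm: "j \<in> hyps G" "m \<in> hyps G"
      using step.hyps(2) unfolding R_iff by blast+
    have "\<exists>d r. a m = d *\<^sub>R a j \<and> fst (snd v $ m) = d *\<^sub>R fst (snd v $ j) + r *\<^sub>R a j"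
    proof (cases "{j, m} \<in> par_edges G (p, l)")
      case True
      then have "parallel (a j) (a m)"
        unfolding par_edges_iff a_def by (elim conjE)
      then obtain d where d: "a m = d *\<^sub>R a j"
        using parallel_iff[OF a_nz a_nz] jm by blast
      then obtain r where "fst (snd v $ m) = d *\<^sub>R fst (snd v $ j) + r *\<^sub>R a j"
        using tangent_vectors_scaled[OF v[unfolded T_def] jm True, of d] by (auto simp: a_def)
      with d show ?thesis by blast
    next
      case False
      then obtain \<gamma> where \<gamma>: "m = act \<gamma> j"
        using step.hyps(2) unfolding R_iff by blast
      have "v \<in> X"
        using v unfolding T_def by (rule tangent_vectors_mem)
      then have "fst (snd v $ m) = fst (snd v $ j)"
        unfolding X_iff \<gamma> \<rho> using jm by simp
      moreover have "a m = a j"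
        unfolding a_def \<gamma> by (rule inv[OF jm(1)])
      ultimately have "a m = 1 *\<^sub>R a j \<and> fst (snd v $ m) = 1 *\<^sub>R fst (snd v $ j) + 0 *\<^sub>R a j"
        by simp
      then show ?thesis by blast
    qed
    then obtain d r where d: "a m = d *\<^sub>R a j" and r: "fst (snd v $ m) = d *\<^sub>R fst (snd v $ j) + r *\<^sub>R a j"
      by blast
    have "a m = (d * c) *\<^sub>R a i \<and> fst (snd v $ m) = (d * c) *\<^sub>R fst (snd v $ i) + (d * s + r * c) *\<^sub>R a i"
      by (simp add: d r c s scaleR_add_right scaleR_add_left add.assoc)
    then show ?case by blast
  qed
  \<comment> \<open>Projection onto \<open>a (k j)\<close> makes \<open>sf\<close> linear in
    \<open>v\<close> on the whole space; on \<open>T\<close> both formulas agree with the scalars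
    supplied by \<open>related\<close>.\<close>
  define cf where "cf j = (a j \<bullet> a (k j)) / (a (k j) \<bullet> a (k j))" for j
  define sf where "sf v j = ((fst (snd v $ j) - cf j *\<^sub>R fst (snd v $ k j)) \<bullet> a (k j)) / (a (k j) \<bullet> a (k j))"
    for v :: "('d, 'v \<times> ((bit option)^'t)) config" and j
  have k_hyps: "k j \<in> hyps G" if "j \<in> hyps G" for j
    using R_hyps[OF k that] .
  have coords: "a j = cf j *\<^sub>R a (k j)" "fst (snd v $ j) = cf j *\<^sub>R fst (snd v $ k j) + sf v j *\<^sub>R a (k j)"
    if v: "v \<in> T" and j: "j \<in> hyps G" for v j
  proof -
    obtain c s where c: "a j = c *\<^sub>R a (k j)" and s: "fst (snd v $ j) = c *\<^sub>R fst (snd v $ k j) + s *\<^sub>R a (k j)"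
      using related[OF v symE[OF k]] by blast
    have "a (k j) \<bullet> a (k j) \<noteq> 0"
      using a_nz[OF k_hyps[OF j]] by simp
    then have "cf j = c" "sf v j = s"
      using c s by (simp_all add: cf_def sf_def)
    with c s show "a j = cf j *\<^sub>R a (k j)" "fst (snd v $ j) = cf j *\<^sub>R fst (snd v $ k j) + sf v j *\<^sub>R a (k j)"
      by simp_all
  qed
  \<comment> \<open>Since \<open>shift\<close> is a difference of values of \<open>offset\<close>,
    pairing \<open>offset \<tau> j\<close> with the correction of the normal gives a scalar
    component that transforms as required.\<close>
  define b where "b v w = (0 :: (real^'d)^('v \<times> ((bit option)^'t)), \<chi> j. if j \<in> hyps G
      then (sf v j *\<^sub>R fst (snd w $ k j), offset \<tau> j \<bullet> (sf v j *\<^sub>R fst (snd w $ k j))) else 0)"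
    for v w :: "('d, 'v \<times> ((bit option)^'t)) config"
  have sf_add: "sf (v + w) j = sf v j + sf w j" and sf_scale: "sf (r *\<^sub>R v) j = r * sf v j" for v w r j
    by (simp_all add: sf_def inner_diff_left inner_add_left add_divide_distrib diff_divide_distrib algebra_simps)
  have "bounded_bilinear b"
    unfolding bilinear_conv_bounded_bilinear[symmetric] bilinear_def
    by (intro conjI allI; rule linearI)
      (simp_all add: b_def prod_eq_iff vec_eq_iff sf_add sf_scale inner_add_right algebra_simps)
  moreover have "(p, l) + v + b v v \<in> (\<lambda>u. (p, l) + u) ` X \<inter> W_set G (par_edges G (p, l))" if v: "v \<in> T" for v
  proof
    have vX: "v \<in> X"
      using v unfolding T_def by (rule tangent_vectors_mem)
    have "b v v \<in> X"
      unfolding X_iff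
    proof (intro conjI allI ballI)
      show "b v v \<in> config_space G"
        by (simp add: b_def config_space_def)
      show "fst (b v v) $ act \<gamma> i = \<rho> \<gamma> *\<^sub>R fst (b v v) $ i" for \<gamma> i
        by (simp add: b_def)
      fix \<gamma> j
      assume j: "j \<in> hyps G"
      have "(j, act \<gamma> j) \<in> R"
        unfolding R_iff using j closed by blast
      then have kj: "k (act \<gamma> j) = k j"
        using k_eq by simp
      moreover have "a (act \<gamma> j) = a j"
        unfolding a_def by (rule inv[OF j])
      moreover have "fst (snd v $ act \<gamma> j) = fst (snd v $ j)"
        using vX j unfolding X_iff \<rho> by simp
      ultimately have "sf v (act \<gamma> j) = sf v j"
        unfolding sf_def cf_def by (simp only:)
      then show "fst (snd (b v v) $ act \<gamma> j) = \<rho> \<gamma> *\<^sub>R fst (snd (b v v) $ j)"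
        "snd (snd (b v v) $ act \<gamma> j) - shift \<tau> \<gamma> j \<bullet> fst (snd (b v v) $ act \<gamma> j) = \<rho> \<gamma> * snd (snd (b v v) $ j)"
        using j closed(2)[rule_format, OF j] kj
        by (simp_all add: b_def \<rho> shift_eq_offset_diff inner_diff_left algebra_simps del: act.simps shift.simps)
    qed
    then have "v + b v v \<in> X"
      using vX subspace_add[OF subX] by blast
    then show inA: "(p, l) + v + b v v \<in> (\<lambda>u. (p, l) + u) ` X"
      unfolding add.assoc by (rule imageI)
    have normal: "fst (snd ((p, l) + v + b v v) $ j) = (cf j + sf v j) *\<^sub>R (a (k j) + fst (snd v $ k j))"
      if j: "j \<in> hyps G" for j
    proof -
      have "fst (snd ((p, l) + v + b v v) $ j) = a j + fst (snd v $ j) + sf v j *\<^sub>R fst (snd v $ k j)"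
        using j by (simp add: b_def a_def)
      also have "\<dots> = (cf j + sf v j) *\<^sub>R (a (k j) + fst (snd v $ k j))"
        using coords[OF v j] by (simp add: algebra_simps)
      finally show ?thesis .
    qed
    show "(p, l) + v + b v v \<in> W_set G (par_edges G (p, l))"
    proof (rule mem_W_setI)
      show "(p, l) + v + b v v \<in> config_space G"
        using vX \<open>b v v \<in> X\<close> config_space_framework[OF fw] unfolding X_iff
        by (intro config_space_add) blast+
      fix i j
      assume ij: "i \<in> hyps G" "j \<in> hyps G" "{i, j} \<in> par_edges G (p, l)"
      then have "k i = k j"
        by (intro k_eq) (simp only: R_iff simp_thms)
      then show "parallel (fst (snd ((p, l) + v + b v v) $ i)) (fst (snd ((p, l) + v + b v v) $ j))"
        unfolding normal[OF ij(1)] normal[OF ij(2)] by (simp only: parallel_scaleR)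
    qed
  qed
  ultimately show ?thesis
    unfolding X_def T_def by (intro exI[of _ b] conjI ballI)
qed

section \<open>Group action and edges of the extrusion graph\<close>

lemma extrusion_simps:
  "pts (extrusion H F) = star_at F ` (pts H \<times> UNIV)"
  "hyps (extrusion H F) = star_at F ` (hyps H \<times> UNIV)"
  "edges (extrusion H F) =
    {star_at F ` \<epsilon> | \<epsilon>. \<epsilon> \<in> edges (cube_product H) \<and> card (star_at F ` \<epsilon>) = 2}"
  by (simp_all add: extrusion_def cube_product_def)

lemma act_star_at: "act \<gamma> (star_at F (u, e)) = star_at F (u, e + \<gamma>)"
  by (simp add: vec_eq_iff)

lemma act_closed_extrusion:
  fixes H :: "'v ph_graph" and F :: "'t::finite \<Rightarrow> 'v set"
  shows
  "\<forall>\<gamma>. \<forall>i\<in>pts (extrusion H F). act \<gamma> i \<in> pts (extrusion H F)"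
  "\<forall>\<gamma>. \<forall>i\<in>hyps (extrusion H F). act \<gamma> i \<in> hyps (extrusion H F)"
proof -
  have "act \<gamma> i \<in> star_at F ` (V \<times> UNIV)" if "i \<in> star_at F ` (V \<times> UNIV)" for \<gamma> i and V :: "'v set"
  proof -
    obtain u e where "u \<in> V" "i = star_at F (u, e)"
      using \<open>i \<in> star_at F ` (V \<times> UNIV)\<close> by (elim imageE SigmaE) (simp only:)
    then show ?thesis
      by (simp only: act_star_at) (rule imageI, simp)
  qed
  then show "\<forall>\<gamma>. \<forall>i\<in>pts (extrusion H F). act \<gamma> i \<in> pts (extrusion H F)"
    "\<forall>\<gamma>. \<forall>i\<in>hyps (extrusion H F). act \<gamma> i \<in> hyps (extrusion H F)"
    unfolding extrusion_simps by blast+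
qed

lemma pts_hyps_extrusion:
  assumes "is_ph_graph H"
  shows "pts (extrusion H F) \<noteq> {}" "pts (extrusion H F) \<inter> hyps (extrusion H F) = {}"
  using assms by (auto simp: extrusion_simps is_ph_graph_def)

text \<open>The two copies differ in one cube coordinate and are joined by an edge of the product;
  contraction either merges its ends or keeps the edge.\<close>

lemma extrusion_copy_edge:
  fixes F :: "'t::finite \<Rightarrow> 'v set" and h :: 't
  assumes j: "j \<in> hyps (extrusion H F)"
  defines "\<gamma> \<equiv> axis h 1"
  shows "act \<gamma> j = j \<or> {j, act \<gamma> j} \<in> edges (extrusion H F)"
proof (rule disjCI)
  assume not_edge: "{j, act \<gamma> j} \<notin> edges (extrusion H F)"
  obtain u e where ue: "u \<in> hyps H" "j = star_at F (u, e)"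
    using j unfolding extrusion_simps by (elim imageE SigmaE) (simp only:)
  have "\<exists>!h'. e $ h' \<noteq> (e + \<gamma>) $ h'"
  proof -
    have eq: "e $ h' \<noteq> (e + \<gamma>) $ h' \<longleftrightarrow> h' = h" for h'
      by (cases "h' = h"; cases "e $ h' = 1") (auto simp: \<gamma>_def axis_def)
    show ?thesis unfolding eq by blast
  qed
  then have cube: "{(u, e), (u, e + \<gamma>)} \<in> edges (cube_product H)"
    unfolding cube_product_def ph_graph.simps using ue(1) by (intro UnI2) blast
  have img: "star_at F ` {(u, e), (u, e + \<gamma>)} = {j, act \<gamma> j}"
    unfolding ue(2) act_star_at by (simp only: image_insert image_empty)
  have "{j, act \<gamma> j} \<in> edges (extrusion H F)" if "card {j, act \<gamma> j} = 2"
    unfolding extrusion_simps mem_Collect_eq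
    by (rule exI[of _ "{(u, e), (u, e + \<gamma>)}"]) (simp only: img cube that simp_thms)
  then show "act \<gamma> j = j"
    using not_edge by (cases "act \<gamma> j = j") (auto simp del: act.simps)
qed

text \<open>Every element is the sum of the unit vectors over its support. Hence a non-trivial
  representation has sign -1 on some generator, and it is the generators that correspond to cube
  edges.\<close>

lemma irreducible_rep_trivial:
  assumes \<rho>: "irreducible_rep \<rho>" and axis: "\<And>h. \<rho> (axis h 1) = 1"
  shows "\<rho> \<gamma> = 1"
proof -
  have add: "\<rho> (\<gamma> + \<delta>) = \<rho> \<gamma> * \<rho> \<delta>" and val: "\<rho> \<gamma> = 1 \<or> \<rho> \<gamma> = -1" for \<gamma> \<delta>
    using \<rho> by (auto simp: irreducible_rep_def)
  have zero: "\<rho> 0 = 1"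
    using add[of 0 0] val[of 0] by auto
  have "\<rho> (\<Sum>h\<in>S. axis h 1) = 1" if "finite S" for S
    using that by induction (simp_all add: zero add axis)
  moreover have "\<gamma> = (\<Sum>h\<in>{h. \<gamma> $ h = 1}. axis h 1)"
    unfolding vec_eq_iff
  proof
    fix i
    have "(\<Sum>h\<in>{h. \<gamma> $ h = 1}. axis h (1::bit)) $ i = (\<Sum>h\<in>{h. \<gamma> $ h = 1}. if h = i then 1 else 0)"
      unfolding sum_component by (rule sum.cong) (auto simp: axis_def)
    also have "\<dots> = \<gamma> $ i"
      by (cases "\<gamma> $ i = 1") (auto simp: sum.delta)
    finally show "\<gamma> $ i = (\<Sum>h\<in>{h. \<gamma> $ h = 1}. axis h 1) $ i" by simp
  qed
  ultimately show ?thesis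
    by (metis finite)
qed

text \<open>
  An edge between two copies of a hyperplane interchanged with sign \<open>-1\<close> forces \<open>v\<^sub>j\<close> to be a
  multiple of \<open>a\<^sub>j\<close>, so that no correction term is needed.
\<close>

lemma chart_nontrivial_representation:
  fixes H :: "'v::finite ph_graph" and F :: "'t::finite \<Rightarrow> 'v set"
    and p :: "(real^'d::finite)^('v \<times> ((bit option)^'t))"
  defines "G \<equiv> extrusion H F"
  assumes fw: "framework G (p, l)"
    and inv: "\<And>\<gamma> j. j \<in> hyps G \<Longrightarrow> fst (l $ act \<gamma> j) = fst (l $ j)"
    and \<rho>: "\<rho> (axis h 1) = - 1"
    and v: "v \<in> tangent_vectors (symmetric_vectors G \<tau> \<rho>) G (p, l)"
  shows "(p, l) + v \<in> (\<lambda>u. (p, l) + u) ` symmetric_vectors G \<tau> \<rho> \<inter> W_set G (par_edges G (p, l))"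
proof
  have closed: "\<forall>\<gamma>. \<forall>i\<in>pts G. act \<gamma> i \<in> pts G" "\<forall>\<gamma>. \<forall>i\<in>hyps G. act \<gamma> i \<in> hyps G"
    unfolding G_def by (rule act_closed_extrusion)+
  have vX: "v \<in> symmetric_vectors G \<tau> \<rho>"
    using v by (rule tangent_vectors_mem)
  then show "(p, l) + v \<in> (\<lambda>u. (p, l) + u) ` symmetric_vectors G \<tau> \<rho>"
    by (rule imageI)
  define a where "a j = fst (l $ j)" for j
  have a_nz: "a j \<noteq> 0" if "j \<in> hyps G" for j
    using fw that by (simp add: a_def)
  have along: "\<exists>s. fst (snd v $ j) = s *\<^sub>R a j" if j: "j \<in> hyps G" for j
  proof -
    define \<gamma> where "\<gamma> = (axis h 1 :: bit^'t)"
    have act_j: "fst (snd v $ act \<gamma> j) = - fst (snd v $ j)"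
      using vX j unfolding symmetric_vectors_iff[OF closed] by (simp add: \<rho> \<gamma>_def del: act.simps)
    have "act \<gamma> j = j \<or> {j, act \<gamma> j} \<in> edges G"
      using extrusion_copy_edge[of j H F h] j unfolding G_def \<gamma>_def by blast
    then show ?thesis
    proof
      assume "act \<gamma> j = j"
      then have "fst (snd v $ j) + fst (snd v $ j) = 0"
        using act_j by (simp only: eq_neg_iff_add_eq_0)
      then have "2 *\<^sub>R fst (snd v $ j) = 0"
        by (simp only: scaleR_2)
      then have "fst (snd v $ j) = 0 *\<^sub>R a j"
        by simp
      then show ?thesis by blast
    next
      assume edge: "{j, act \<gamma> j} \<in> edges G"
      have "parallel (fst (l $ j)) (fst (l $ act \<gamma> j))"
        unfolding inv[OF j] using parallel_scaleR[of 1 "fst (l $ j)" 1] by simp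
      then have par: "{j, act \<gamma> j} \<in> par_edges G (p, l)"
        using edge j closed unfolding par_edges_iff by blast
      have "fst (l $ act \<gamma> j) = 1 *\<^sub>R fst (l $ j)"
        using inv[OF j] by simp
      then obtain s where "fst (snd v $ act \<gamma> j) = 1 *\<^sub>R fst (snd v $ j) + s *\<^sub>R fst (l $ j)"
        using tangent_vectors_scaled[OF v j closed(2)[rule_format, OF j] par, of 1] by auto
      then have "- fst (snd v $ j) = 1 *\<^sub>R fst (snd v $ j) + s *\<^sub>R a j"
        unfolding act_j a_def .
      then have "2 *\<^sub>R fst (snd v $ j) = (- s) *\<^sub>R a j"
        by (simp only: scaleR_2 scaleR_minus_left scaleR_one neg_eq_iff_add_eq_0 eq_neg_iff_add_eq_0 add.assoc)
      then have "(1 / 2) *\<^sub>R 2 *\<^sub>R fst (snd v $ j) = (1 / 2) *\<^sub>R (- s) *\<^sub>R a j"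
        by (rule arg_cong)
      then have "fst (snd v $ j) = (- s / 2) *\<^sub>R a j"
        by simp
      then show ?thesis by blast
    qed
  qed
  \<comment> \<open>Each normal stays on its own line, so parallel pairs stay parallel.\<close>
  show "(p, l) + v \<in> W_set G (par_edges G (p, l))"
  proof (rule mem_W_setI)
    show "(p, l) + v \<in> config_space G"
      using vX fw unfolding symmetric_vectors_iff[OF closed] by (intro config_space_add) auto
    fix i j
    assume ij: "i \<in> hyps G" "j \<in> hyps G" "{i, j} \<in> par_edges G (p, l)"
    then have "parallel (a i) (a j)"
      unfolding par_edges_iff a_def by (elim conjE)
    then obtain c where c: "a j = c *\<^sub>R a i"
      using parallel_iff[OF a_nz a_nz] ij by blast
    obtain s r where s: "fst (snd v $ i) = s *\<^sub>R a i" and r: "fst (snd v $ j) = r *\<^sub>R a j"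
      using along ij by blast
    have "fst (snd ((p, l) + v) $ i) = (1 + s) *\<^sub>R a i"
      using s by (simp add: a_def algebra_simps)
    moreover have "fst (snd ((p, l) + v) $ j) = a j + r *\<^sub>R a j"
      using r by (simp add: a_def)
    then have "fst (snd ((p, l) + v) $ j) = ((1 + r) * c) *\<^sub>R a i"
      by (simp add: c algebra_simps)
    ultimately show "parallel (fst (snd ((p, l) + v) $ i)) (fst (snd ((p, l) + v) $ j))"
      by (simp only: parallel_scaleR)
  qed
qed

section \<open>Existence of a finite flex\<close>

lemma finite_flex_of_curve:
  assumes G: "pts G \<noteq> {}" "pts G \<inter> hyps G = {}"
    and fw: "framework G (p, l)"
    and nontrivial: "\<not> trivial_motion G (p, l) u"
    and e: "e > 0" and c0: "c 0 = (p, l)" and der: "(c has_vector_derivative u) (at 0)"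
    and diff: "\<And>t. \<bar>t\<bar> < e \<Longrightarrow> c differentiable at t"
    and W: "\<And>t. \<bar>t\<bar> < e \<Longrightarrow> c t \<in> W_set G (par_edges G (p, l))"
    and fibre: "\<And>t. \<bar>t\<bar> < e \<Longrightarrow> f_map G (par_edges G (p, l)) (c t) = f_map G (par_edges G (p, l)) (p, l)"
  shows "\<exists>x. finite_flex G (p, l) x"
proof -
  define cong where "cong t \<longleftrightarrow> c t \<in> W_set (complete_on G) (class_edges G (p, l)) \<and>
    f_map (complete_on G) (class_edges G (p, l)) (c t) = f_map (complete_on G) (class_edges G (p, l)) (p, l)" for t
  have "\<not> (\<exists>\<^sub>F t in at_right 0. cong t)"
    using trivial_motion_of_congruent_path[OF G fw c0 der] nontrivial unfolding cong_def by blast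
  then have "\<forall>\<^sub>F t in at_right 0. \<not> cong t"
    by (simp only: not_frequently)
  then obtain d where d: "d > 0" "\<And>t. 0 < t \<Longrightarrow> t < d \<Longrightarrow> \<not> cong t"
    unfolding eventually_at_right[OF zero_less_one] by blast
  \<comment> \<open>Halving makes both bounds strict, so they still hold at the end point
    \<open>T = 1\<close>.\<close>
  define r where "r = min d e / 2"
  have r: "0 < r" "r < d" "r < e"
    using d(1) e by (auto simp: r_def min_def)
  define x where "x T = c (T * r)" for T
  have range: "T * r \<le> r" "\<bar>T * r\<bar> < e" if "T \<in> {0..1}" for T
  proof -
    have "0 \<le> T * r" and *: "T * r \<le> r"
      using r that by (simp_all add: mult_left_le_one_le)
    then show "T * r \<le> r" "\<bar>T * r\<bar> < e"
      using r(3) by simp_all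
  qed
  have "x differentiable_on {0..1}"
    unfolding differentiable_on_def
  proof
    fix T :: real
    assume "T \<in> {0..1}"
    then have "\<bar>T * r\<bar> < e"
      by (rule range)
    then have "c differentiable at (T * r)"
      by (rule diff)
    then have "(c \<circ> (\<lambda>T. T * r)) differentiable at T"
      by (intro differentiable_chain_at) simp_all
    then show "x differentiable at T within {0..1}"
      unfolding x_def[abs_def] o_def by (rule differentiable_at_withinI)
  qed
  moreover have "x ` {0..1} \<subseteq> W_set G (par_edges G (p, l))"
  proof (rule image_subsetI)
    fix T :: real
    assume "T \<in> {0..1}"
    then show "x T \<in> W_set G (par_edges G (p, l))"
      unfolding x_def by (intro W range)
  qed
  moreover have "x 0 = (p, l)"
    by (simp add: x_def c0)
  moreover have "x T \<in> {y \<in> W_set G (par_edges G (p, l)). f_map G (par_edges G (p, l)) y = f_map G (par_edges G (p, l)) (p, l)}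
      - {y \<in> W_set (complete_on G) (class_edges G (p, l)).
          f_map (complete_on G) (class_edges G (p, l)) y = f_map (complete_on G) (class_edges G (p, l)) (p, l)}"
    if T: "T \<in> {0<..1}" for T
  proof -
    have "T * r < d"
      by (rule le_less_trans[OF range(1) r(2)]) (use T in simp)
    then have "\<not> cong (T * r)"
      using T r by (intro d(2)) simp_all
    moreover have "\<bar>T * r\<bar> < e"
      using T by (intro range) simp
    ultimately show ?thesis
      using W fibre unfolding cong_def x_def by blast
  qed
  ultimately show ?thesis
    unfolding finite_flex_def Let_def by (intro exI[of _ x] conjI ballI)
qed

theorem theorem5p9:
  fixes H :: "'v::finite ph_graph"
    and F :: "'t::finite \<Rightarrow> 'v set"
    and G :: "('v \<times> ((bit option)^'t)) ph_graph"
    and \<tau> :: "'t \<Rightarrow> real^'d::finite"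
    and p :: "(real^'d)^('v \<times> ((bit option)^'t))"
    and l :: "((real^'d) \<times> real)^('v \<times> ((bit option)^'t))"
    and \<rho> :: "bit^'t \<Rightarrow> real"
  assumes "is_ph_graph H"
    and "\<And>h. F h \<subseteq> hyps H"
    and "G = extrusion H F"
    and "framework G (p, l)"
    and "extrusion_symmetric H F \<tau> (p, l)"
    and "affinely_spanning G (p, l)"
    and "irreducible_rep \<rho>"
    and "regular_point_in ((\<lambda>u. (p, l) + u) ` symmetric_vectors G \<tau> \<rho>) G (p, l) (p, l)"
    and "\<exists>u \<in> symmetric_vectors G \<tau> \<rho>. infinitesimal_flex G (p, l) u"
  shows "\<exists>x. finite_flex G (p, l) x"
proof -
  note G = assms(3) and fw = assms(4)
  define X where "X = symmetric_vectors G \<tau> \<rho>"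
  define B where "B = par_edges G (p, l)"
  define D where "D = (\<lambda>u. (p, l) + u) ` X \<inter> W_set G B"
  define T where "T = tangent_vectors X G (p, l)"
  have closed: "\<forall>\<gamma>. \<forall>i\<in>pts G. act \<gamma> i \<in> pts G" "\<forall>\<gamma>. \<forall>i\<in>hyps G. act \<gamma> i \<in> hyps G"
    unfolding G by (rule act_closed_extrusion)+
  have subX: "subspace X"
    unfolding X_def by (rule subspace_symmetric_vectors[OF closed])
  have inv: "fst (l $ act \<gamma> j) = fst (l $ j)" if "j \<in> hyps G" for \<gamma> j
    using assms(5) that unfolding G extrusion_symmetric.simps by blast
  \<comment> \<open>Both cases yield a chart of the same quadratic form; in the non-trivial case the
    quadratic term is 0.\<close>
  have "\<exists>b. bounded_bilinear b \<and> (\<forall>v\<in>T. (p, l) + v + b v v \<in> D)"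
  proof (cases "\<forall>h. \<rho> (axis h 1) = 1")
    case True
    then have "\<rho> \<gamma> = 1" for \<gamma>
      using irreducible_rep_trivial[OF assms(7)] by blast
    from chart_trivial_representation[OF closed fw inv this] show ?thesis
      unfolding D_def T_def X_def B_def .
  next
    case False
    then obtain h where "\<rho> (axis h 1) = - 1"
      using assms(7) unfolding irreducible_rep_def by blast
    from chart_nontrivial_representation[where \<rho> = \<rho> and h = h and \<tau> = \<tau>, OF fw[unfolded G] inv[unfolded G] this]
    have "(p, l) + v \<in> D" if "v \<in> T" for v
      using that unfolding D_def T_def X_def B_def G by blast
    moreover have "bilinear (\<lambda>(_ :: ('d, 'v \<times> ((bit option)^'t)) config) (_ :: ('d, 'v \<times> ((bit option)^'t)) config). 0 :: ('d, 'v \<times> ((bit option)^'t)) config)"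
      by (simp add: bilinear_def linear_iff)
    ultimately show ?thesis
      unfolding bilinear_conv_bounded_bilinear by (intro exI[of _ "\<lambda>_ _. 0"] conjI ballI) simp_all
  qed
  then obtain b where b: "bounded_bilinear b" and bD: "\<forall>v\<in>T. (p, l) + v + b v v \<in> D"
    by blast
  obtain \<phi>' where \<phi>': "\<And>v. ((\<lambda>v. (p, l) + v + b v v) has_derivative blinfun_apply (\<phi>' v)) (at v)"
    "continuous_on UNIV \<phi>'" "\<And>x v. \<phi>' x v = v + (b x v + b v x)"
    by (rule quadratic_map_C1[OF b bounded_linear_ident refl]) blast
  obtain f' where f': "\<And>x. (f_map G B has_derivative blinfun_apply (f' x)) (at (x :: ('d, 'v \<times> ((bit option)^'t)) config))"
    "continuous_on UNIV f'" "\<And>x v. f' x v = f_lin G v + (f_bil G B x v + f_bil G B v x)"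
    by (rule quadratic_map_C1[OF bounded_bilinear_f_bil bounded_linear_f_lin f_map_quadratic]) blast
  have tangent: "tangent_space D (p, l) \<subseteq> T"
    unfolding D_def B_def T_def by (rule tangent_space_subset_tangent_vectors[OF subX fw])
  have reg: "\<forall>\<^sub>F y in nhds (p, l). y \<in> D \<longrightarrow> restricted_rank D (f_map G B) y \<le> restricted_rank D (f_map G B) (p, l)"
  proof -
    obtain N where N: "openin (top_of_set ((\<lambda>u. (p, l) + u) ` X)) N" "(p, l) \<in> N"
      "\<And>y. y \<in> N \<inter> D \<Longrightarrow> restricted_rank D (f_map G B) y \<le> restricted_rank D (f_map G B) (p, l)"
      using assms(8) unfolding regular_point_in_def Let_def D_def X_def B_def by blast
    obtain U where U: "open U" "N = (\<lambda>u. (p, l) + u) ` X \<inter> U"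
      using N(1) unfolding openin_open by blast
    have "D \<subseteq> (\<lambda>u. (p, l) + u) ` X"
      unfolding D_def by (rule Int_lower1)
    then show ?thesis
      unfolding eventually_nhds using N(2,3) U by (intro exI[of _ U]) blast
  qed
  obtain u where u: "u \<in> X" "infinitesimal_motion G (p, l) u" "\<not> trivial_motion G (p, l) u"
    using assms(9) unfolding infinitesimal_flex_def X_def by blast
  \<comment> \<open>The flex satisfies the linearized parallelism by definition, so it is an
    admissible initial velocity.\<close>
  have uT: "u \<in> T"
    unfolding T_def by (rule infinitesimal_motion_tangent_vectors[OF u(2,1)])
  have f'u: "f' (p, l) u = 0"
    unfolding f'(3) B_def by (rule f_map_derivative_infinitesimal_motion[OF u(2)])
  have \<phi>0: "(p, l) + 0 + b 0 0 = (p, l)" "\<forall>v\<in>T. \<phi>' 0 v = v"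
    using \<phi>'(3) by (simp_all add: bounded_bilinear.zero_left[OF b] bounded_bilinear.zero_right[OF b])
  have subT: "subspace T"
    unfolding T_def by (rule subspace_tangent_vectors[OF subX])
  obtain c e where c: "e > 0" "c 0 = (p, l)" "(c has_vector_derivative u) (at 0)"
    "\<forall>t. \<bar>t\<bar> < e \<longrightarrow> c differentiable at t \<and> c t \<in> D \<and> f_map G B (c t) = f_map G B (p, l)"
    using regular_constrained_curve[OF f'(1,2) \<phi>'(1,2) subT \<phi>0 bD tangent reg uT f'u] by blast
  show ?thesis
  proof (rule finite_flex_of_curve[OF _ _ fw u(3) c(1-3)])
    show "pts G \<noteq> {}" "pts G \<inter> hyps G = {}"
      unfolding G by (rule pts_hyps_extrusion[OF assms(1)])+
  qed (use c(4) in \<open>auto simp: D_def B_def\<close>)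
qed

end
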